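(* Let $N\ge 2$. (i) For $z\in S(\mathbf C^N)^{\otimes *}$, the representation $GP(z)$ of $\mathcal O_N$ is irreducible if and only if $z$ is nonperiodic (i.e. not periodic). (ii) For $z\in S(\mathbf C^N)^{\infty}$, the representation $GP(z)$ of $\mathcal O_N$ is irreducible if and only if $z$ is not asymptotically periodic.
   Context: $\mathcal O_N$ ($N\ge2$) is the Cuntz algebra: the universal C$^*$-algebra generated by $s_1,\dots,s_N$ with $s_i^*s_j=\delta_{ij}I$ and $\sum_{i=1}^N s_is_i^*=I$. A representation means a unital $*$-representation on a complex Hilbert space. $\mathbf N=\{1,2,3,\dots\}$. $\langle\cdot|\cdot\rangle$ is linear in the second variable. Parameter sets: $S(\mathbf C^N)=\{z\in\mathbf C^N:\|z\|=1\}$; $S(\mathbf C^N)^{\otimes k}=\{z^{(1)}\otimes\cdots\otimes z^{(k)}: z^{(i)}\in S(\mathbf C^N)\}$ for $k\ge1$; $S(\mathbf C^N)^{\otimes *}=\coprod_{k\ge1}S(\mathbf C^N)^{\otimes k}$; $S(\mathbf C^N)^\infty=\{(z^{(n)})_{n\in\mathbf N}: z^{(n)}\in S(\mathbf C^N)\}$. For $z=(z_1,\dots,z_N)\in\mathbf C^N$ put $s(z)=z_1s_1+\cdots+z_Ns_N$, and for $z=z^{(1)}\otimes\cdots\otimes z^{(k)}$ put $s(z)=s(z^{(1)})\cdots s(z^{(k)})$. Definition. (cycle) For $z=z^{(1)}\otimes\cdots\otimes z^{(k)}\in S(\mathbf C^N)^{\otimes k}$, a representation $(\mathcal H,\pi)$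 of $\mathcal O_N$ is $GP(z)$ if there is a unit cyclic vector $\Omega\in\mathcal H$ such that $\pi(s(z))\Omega=\Omega$ and $\{\pi(s(z^{(i)})\cdots s(z^{(k)}))\Omega\}_{i=1}^k$ is an orthonormal family. (chain) For $z=(z^{(n)})_{n\in\mathbf N}\in S(\mathbf C^N)^\infty$, $(\mathcal H,\pi)$ is $GP(z)$ if there is a unit cyclic vector $\Omega\in\mathcal H$ such that $\{\pi(s(z^{(n)})^*\cdots s(z^{(1)})^* )\Omega: n\in\mathbf N\}$ is an orthonormal family. For every such $z$ a representation which is $GP(z)$ exists and is unique up to unitary equivalence, so $GP(z)$ also denotes this equivalence class. Periodicity: $z\in S(\mathbf C^N)^{\otimes *}$ is periodic if $z=y^{\otimes p}$ for some $l\ge1$, $y\in S(\mathbf C^N)^{\otimes l}$ and $p\ge2$. $z=(z^{(n)})_{n\in\mathbf N}\in S(\mathbf C^N)^\infty$ is asymptotically periodic if there is a positive integer $p$ with $\sum_{n=1}^\infty(1-|\langle z^{(n)}|z^{(n+p)}\rangle|)<\infty$. *)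

theory Defs
  imports "HOL-Analysis.Analysis"
begin

section \<open>Complex Hilbert spaces and unital C*-algebras\<close>

class scaleC =
  fixes scaleC :: "complex \<Rightarrow> 'a \<Rightarrow> 'a"  (infixr \<open>*\<^sub>C\<close> 75)

class complex_vector = scaleC + real_vector +
  assumes scaleC_add_right: "a *\<^sub>C (x + y) = a *\<^sub>C x + a *\<^sub>C y"
    and scaleC_add_left: "(a + b) *\<^sub>C x = a *\<^sub>C x + b *\<^sub>C x"
    and scaleC_scaleC: "a *\<^sub>C (b *\<^sub>C x) = (a * b) *\<^sub>C x"
    and scaleR_scaleC: "r *\<^sub>R x = complex_of_real r *\<^sub>C x"

text \<open>The inner product is linear in the second variable.\<close>

class chilbert_space = complex_vector + banach +
  fixes cinner :: "'a \<Rightarrow> 'a \<Rightarrow> complex"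
  assumes cinner_commute: "cinner x y = cnj (cinner y x)"
    and cinner_add_right: "cinner x (y + z) = cinner x y + cinner x z"
    and cinner_scaleC_right: "cinner x (a *\<^sub>C y) = a * cinner x y"
    and cinner_self: "cinner x x = complex_of_real ((norm x)\<^sup>2)"

text \<open>
  Via \<open>real_normed_algebra_1\<close> the algebra is unital with \<open>norm 1 = 1\<close>, which for a
  C*-algebra just says that it is nonzero.
\<close>

class cstar_algebra_1 = complex_vector + real_normed_algebra_1 + banach +
  fixes star :: "'a \<Rightarrow> 'a"
  assumes scaleC_mult_left: "(a *\<^sub>C x) * y = a *\<^sub>C (x * y)"
    and scaleC_mult_right: "x * (a *\<^sub>C y) = a *\<^sub>C (x * y)"
    and norm_scaleC: "norm (a *\<^sub>C x) = cmod a * norm x"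
    and star_add: "star (x + y) = star x + star y"
    and star_scaleC: "star (a *\<^sub>C x) = cnj a *\<^sub>C star x"
    and star_mult: "star (x * y) = star y * star x"
    and star_star: "star (star x) = x"
    and norm_star_mult: "norm (star x * x) = (norm x)\<^sup>2"

definition bounded_clinear :: "('h::chilbert_space \<Rightarrow> 'h) \<Rightarrow> bool" where
  "bounded_clinear T \<longleftrightarrow> bounded_linear T \<and> (\<forall>c x. T (c *\<^sub>C x) = c *\<^sub>C T x)"

definition is_adjoint :: "('h::chilbert_space \<Rightarrow> 'h) \<Rightarrow> ('h \<Rightarrow> 'h) \<Rightarrow> bool" where
  "is_adjoint T' T \<longleftrightarrow> (\<forall>x y. cinner (T' x) y = cinner x (T y))"

definition representation :: "('a::cstar_algebra_1 \<Rightarrow> 'h::chilbert_space \<Rightarrow> 'h) \<Rightarrow> bool" where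
  "representation \<pi> \<longleftrightarrow>
     (\<forall>a. bounded_clinear (\<pi> a)) \<and>
     (\<forall>a b x. \<pi> (a + b) x = \<pi> a x + \<pi> b x) \<and>
     (\<forall>c a x. \<pi> (c *\<^sub>C a) x = c *\<^sub>C \<pi> a x) \<and>
     (\<forall>a b. \<pi> (a * b) = \<pi> a \<circ> \<pi> b) \<and>
     \<pi> 1 = id \<and>
     (\<forall>a. is_adjoint (\<pi> (star a)) (\<pi> a))"

definition irreducible_rep :: "('a::cstar_algebra_1 \<Rightarrow> 'h::chilbert_space \<Rightarrow> 'h) \<Rightarrow> bool" where
  "irreducible_rep \<pi> \<longleftrightarrow>
     (\<exists>x::'h. x \<noteq> 0) \<and>
     (\<forall>K. closed K \<and> 0 \<in> K \<and> (\<forall>x\<in>K. \<forall>y\<in>K. x + y \<in> K) \<and> (\<forall>c. \<forall>x\<in>K. c *\<^sub>C x \<in> K) \<and>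
          (\<forall>a. \<pi> a ` K \<subseteq> K) \<longrightarrow> K = {0} \<or> K = UNIV)"

definition unit_cyclic_vector ::
    "('a::cstar_algebra_1 \<Rightarrow> 'h::chilbert_space \<Rightarrow> 'h) \<Rightarrow> 'h \<Rightarrow> bool" where
  "unit_cyclic_vector \<pi> \<Omega> \<longleftrightarrow> norm \<Omega> = 1 \<and> closure (range (\<lambda>a. \<pi> a \<Omega>)) = UNIV"


section \<open>The Hilbert space of square-summable sequences\<close>

typedef ell2 = "{f :: nat \<Rightarrow> complex. summable (\<lambda>n. (cmod (f n))\<^sup>2)}"
  morphisms ell2_nth Abs_ell2
  by (rule exI[of _ "\<lambda>_. 0"]) simp

setup_lifting type_definition_ell2

lemma summable_ell2: "summable (\<lambda>n. (cmod (ell2_nth x n))\<^sup>2)"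
  using ell2_nth[of x] by simp

lemma L2_le_imp_ell2:
  fixes f :: "nat \<Rightarrow> complex"
  assumes "\<And>n. L2_set (\<lambda>i. cmod (f i)) {..<n} \<le> B"
  shows "summable (\<lambda>n. (cmod (f n))\<^sup>2)" and "sqrt (\<Sum>n. (cmod (f n))\<^sup>2) \<le> B"
proof -
  have B: "B \<ge> 0" using assms[of 0] by simp
  have le: "(\<Sum>i<n. (cmod (f i))\<^sup>2) \<le> B\<^sup>2" for n
    using assms[of n] B by (simp add: L2_set_def real_sqrt_le_iff' real_le_lsqrt sqrt_le_D)
  show s: "summable (\<lambda>n. (cmod (f n))\<^sup>2)"
    by (rule summableI_nonneg_bounded[OF _ le]) simp
  have "(\<Sum>n. (cmod (f n))\<^sup>2) \<le> B\<^sup>2"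
    by (rule suminf_le_const[OF s le])
  then show "sqrt (\<Sum>n. (cmod (f n))\<^sup>2) \<le> B"
    using B by (simp add: real_le_lsqrt suminf_nonneg s)
qed

lemma ell2_imp_L2_le:
  fixes f :: "nat \<Rightarrow> complex"
  assumes "summable (\<lambda>n. (cmod (f n))\<^sup>2)"
  shows "L2_set (\<lambda>i. cmod (f i)) {..<n} \<le> sqrt (\<Sum>n. (cmod (f n))\<^sup>2)"
  unfolding L2_set_def using assms by (simp add: sum_le_suminf)

lemma L2_cmod_add_le:
  "L2_set (\<lambda>i. cmod (f i + g i)) A \<le> L2_set (\<lambda>i. cmod (f i)) A + L2_set (\<lambda>i. cmod (g i)) A"
  by (rule order_trans[OF L2_set_mono L2_set_triangle_ineq]) (auto intro: norm_triangle_ineq)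

lemma ell2_add:
  fixes f g :: "nat \<Rightarrow> complex"
  assumes "summable (\<lambda>n. (cmod (f n))\<^sup>2)" "summable (\<lambda>n. (cmod (g n))\<^sup>2)"
  shows "summable (\<lambda>n. (cmod (f n + g n))\<^sup>2)"
    and "sqrt (\<Sum>n. (cmod (f n + g n))\<^sup>2)
           \<le> sqrt (\<Sum>n. (cmod (f n))\<^sup>2) + sqrt (\<Sum>n. (cmod (g n))\<^sup>2)"
proof -
  have *: "L2_set (\<lambda>i. cmod (f i + g i)) {..<n}
      \<le> sqrt (\<Sum>n. (cmod (f n))\<^sup>2) + sqrt (\<Sum>n. (cmod (g n))\<^sup>2)" for n
    using L2_cmod_add_le[of f g "{..<n}"] ell2_imp_L2_le[OF assms(1), of n]
      ell2_imp_L2_le[OF assms(2), of n] by linarith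
  show "summable (\<lambda>n. (cmod (f n + g n))\<^sup>2)"
    and "sqrt (\<Sum>n. (cmod (f n + g n))\<^sup>2)
           \<le> sqrt (\<Sum>n. (cmod (f n))\<^sup>2) + sqrt (\<Sum>n. (cmod (g n))\<^sup>2)"
    using L2_le_imp_ell2[OF *] by auto
qed

lemma ell2_scale:
  fixes f :: "nat \<Rightarrow> complex"
  assumes "summable (\<lambda>n. (cmod (f n))\<^sup>2)"
  shows "summable (\<lambda>n. (cmod (c * f n))\<^sup>2)"
    and "sqrt (\<Sum>n. (cmod (c * f n))\<^sup>2) = cmod c * sqrt (\<Sum>n. (cmod (f n))\<^sup>2)"
  using assms
  by (simp_all add: norm_mult power_mult_distrib suminf_mult real_sqrt_mult summable_mult)

instantiation ell2 :: complex_vector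
begin

lift_definition zero_ell2 :: ell2 is "\<lambda>_. 0" by simp
lift_definition plus_ell2 :: "ell2 \<Rightarrow> ell2 \<Rightarrow> ell2" is "\<lambda>f g n. f n + g n"
  by (rule ell2_add)
lift_definition uminus_ell2 :: "ell2 \<Rightarrow> ell2" is "\<lambda>f n. - f n" by simp
lift_definition minus_ell2 :: "ell2 \<Rightarrow> ell2 \<Rightarrow> ell2" is "\<lambda>f g n. f n - g n"
  subgoal for f g using ell2_add(1)[of f "\<lambda>n. - g n"] by simp
  done
lift_definition scaleC_ell2 :: "complex \<Rightarrow> ell2 \<Rightarrow> ell2" is "\<lambda>c f n. c * f n"
  by (rule ell2_scale)
definition scaleR_ell2 :: "real \<Rightarrow> ell2 \<Rightarrow> ell2" where
  "scaleR_ell2 r x = complex_of_real r *\<^sub>C x"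

instance
  by standard (unfold scaleR_ell2_def, (transfer, simp add: algebra_simps fun_eq_iff)+)

end

instantiation ell2 :: real_normed_vector
begin

lift_definition norm_ell2 :: "ell2 \<Rightarrow> real" is "\<lambda>f. sqrt (\<Sum>n. (cmod (f n))\<^sup>2)" .
definition sgn_ell2 :: "ell2 \<Rightarrow> ell2" where "sgn_ell2 x = x /\<^sub>R norm x"
definition dist_ell2 :: "ell2 \<Rightarrow> ell2 \<Rightarrow> real" where "dist_ell2 x y = norm (x - y)"
definition uniformity_ell2 :: "(ell2 \<times> ell2) filter" where
  "uniformity_ell2 = (INF e\<in>{0<..}. principal {(x, y). dist x y < e})"
definition open_ell2 :: "ell2 set \<Rightarrow> bool" where
  "open_ell2 U \<longleftrightarrow> (\<forall>x\<in>U. eventually (\<lambda>(x', y). x' = x \<longrightarrow> y \<in> U) uniformity)"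

instance
proof
  fix x y :: ell2 and r :: real
  show "(norm x = 0) = (x = 0)"
    by transfer (auto simp: fun_eq_iff suminf_eq_zero_iff)
  show "norm (x + y) \<le> norm x + norm y"
    by transfer (rule ell2_add)
  show "norm (r *\<^sub>R x) = \<bar>r\<bar> * norm x"
    unfolding scaleR_ell2_def
    by (transfer, subst ell2_scale(2)) auto
qed (rule sgn_ell2_def dist_ell2_def uniformity_ell2_def open_ell2_def)+

end

lemma ell2_nth_simps:
  "ell2_nth (x + y) n = ell2_nth x n + ell2_nth y n"
  "ell2_nth (x - y) n = ell2_nth x n - ell2_nth y n"
  "ell2_nth (c *\<^sub>C x) n = c * ell2_nth x n"
  by (simp_all add: plus_ell2.rep_eq minus_ell2.rep_eq scaleC_ell2.rep_eq)

lemma L2_ell2_nth_le_norm: "L2_set (\<lambda>i. cmod (ell2_nth x i)) {..<n} \<le> norm x"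
  unfolding norm_ell2.rep_eq by (rule ell2_imp_L2_le[OF summable_ell2])

lemma cmod_ell2_nth_le_norm: "cmod (ell2_nth x n) \<le> norm x"
proof -
  have "cmod (ell2_nth x n) \<le> L2_set (\<lambda>i. cmod (ell2_nth x i)) {..<Suc n}"
    by (rule member_le_L2_set) auto
  with L2_ell2_nth_le_norm[of x "Suc n"] show ?thesis by linarith
qed

instance ell2 :: banach
proof
  fix X :: "nat \<Rightarrow> ell2"
  assume C: "Cauchy X"
  have "\<exists>l. (\<lambda>k. ell2_nth (X k) n) \<longlonglongrightarrow> l" for n
  proof -
    have "Cauchy (\<lambda>k. ell2_nth (X k) n)"
    proof (rule metric_CauchyI)
      fix e :: real assume "e > 0"
      then obtain M where M: "\<And>k m. k \<ge> M \<Longrightarrow> m \<ge> M \<Longrightarrow> dist (X k) (X m) < e"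
        using metric_CauchyD[OF C] by blast
      have "dist (ell2_nth (X k) n) (ell2_nth (X m) n) \<le> dist (X k) (X m)" for k m
        using cmod_ell2_nth_le_norm[of "X k - X m" n]
        by (simp add: dist_norm ell2_nth_simps)
      then show "\<exists>M. \<forall>k\<ge>M. \<forall>m\<ge>M. dist (ell2_nth (X k) n) (ell2_nth (X m) n) < e"
        using M by (meson order_le_less_trans)
    qed
    then show ?thesis by (simp add: Cauchy_convergent_iff convergent_def)
  qed
  then obtain f where f: "\<And>n. (\<lambda>k. ell2_nth (X k) n) \<longlonglongrightarrow> f n" by metis
  have tail: "\<exists>M. \<forall>k\<ge>M. \<forall>n. L2_set (\<lambda>i. cmod (ell2_nth (X k) i - f i)) {..<n} \<le> e"
    if "e > 0" for e
  proof -
    obtain M where M: "\<And>k m. k \<ge> M \<Longrightarrow> m \<ge> M \<Longrightarrow> dist (X k) (X m) < e"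
      using metric_CauchyD[OF C \<open>e > 0\<close>] by blast
    have "L2_set (\<lambda>i. cmod (ell2_nth (X k) i - f i)) {..<n} \<le> e" if "k \<ge> M" for k n
    proof (rule LIMSEQ_le_const2)
      show "(\<lambda>m. L2_set (\<lambda>i. cmod (ell2_nth (X k) i - ell2_nth (X m) i)) {..<n})
              \<longlonglongrightarrow> L2_set (\<lambda>i. cmod (ell2_nth (X k) i - f i)) {..<n}"
        unfolding L2_set_def by (intro tendsto_intros f)
      have "L2_set (\<lambda>i. cmod (ell2_nth (X k) i - ell2_nth (X m) i)) {..<n} \<le> e"
        if "m \<ge> M" for m
        using L2_ell2_nth_le_norm[of "X k - X m" n] M[OF \<open>k \<ge> M\<close> that]
        by (simp add: dist_norm ell2_nth_simps)
      then show "\<exists>N. \<forall>m\<ge>N. L2_set (\<lambda>i. cmod (ell2_nth (X k) i - ell2_nth (X m) i)) {..<n} \<le> e"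
        by blast
    qed
    then show ?thesis by blast
  qed
  obtain M where M: "\<And>n. L2_set (\<lambda>i. cmod (ell2_nth (X M) i - f i)) {..<n} \<le> 1"
    using tail[of 1] by auto
  have "summable (\<lambda>n. (cmod (f n))\<^sup>2)"
    using ell2_add(1)[OF summable_ell2[of "X M"], of "\<lambda>i. - (ell2_nth (X M) i - f i)"]
      L2_le_imp_ell2(1)[OF M] by (simp add: norm_minus_commute)
  then have nth_f: "ell2_nth (Abs_ell2 f) = f" by (simp add: Abs_ell2_inverse)
  have "X \<longlonglongrightarrow> Abs_ell2 f"
  proof (rule metric_LIMSEQ_I)
    fix e :: real assume "e > 0"
    then obtain M where M:
        "\<And>k n. k \<ge> M \<Longrightarrow> L2_set (\<lambda>i. cmod (ell2_nth (X k) i - f i)) {..<n} \<le> e / 2"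
      using tail[of "e / 2"] by auto
    have "dist (X k) (Abs_ell2 f) \<le> e / 2" if "k \<ge> M" for k
      unfolding dist_norm norm_ell2.rep_eq ell2_nth_simps nth_f
      by (rule L2_le_imp_ell2(2)[OF M[OF that]])
    then show "\<exists>M. \<forall>k\<ge>M. dist (X k) (Abs_ell2 f) < e"
      using \<open>e > 0\<close> by (intro exI[of _ M]) (force intro: order_le_less_trans)
  qed
  then show "convergent X" by (auto simp: convergent_def)
qed

lemma summable_cnj_mult_ell2: "summable (\<lambda>n. cnj (ell2_nth x n) * ell2_nth y n)"
proof (rule summable_comparison_test')
  show "summable (\<lambda>n. (cmod (ell2_nth x n))\<^sup>2 + (cmod (ell2_nth y n))\<^sup>2)"
    by (intro summable_add summable_ell2)
  fix n
  show "norm (cnj (ell2_nth x n) * ell2_nth y n)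
          \<le> (cmod (ell2_nth x n))\<^sup>2 + (cmod (ell2_nth y n))\<^sup>2"
    using sum_squares_bound[of "cmod (ell2_nth x n)" "cmod (ell2_nth y n)"]
      mult_nonneg_nonneg[OF norm_ge_zero norm_ge_zero, of "ell2_nth x n" "ell2_nth y n"]
    unfolding norm_mult complex_mod_cnj by linarith
qed

instantiation ell2 :: chilbert_space
begin

definition cinner_ell2 :: "ell2 \<Rightarrow> ell2 \<Rightarrow> complex" where
  "cinner_ell2 x y = (\<Sum>n. cnj (ell2_nth x n) * ell2_nth y n)"

instance
proof
  fix x y z :: ell2 and a :: complex
  show "cinner x y = cnj (cinner y x)"
    unfolding cinner_ell2_def
    using bounded_linear.suminf[OF bounded_linear_cnj summable_cnj_mult_ell2[of y x]]
    by (simp add: mult.commute)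
  show "cinner x (y + z) = cinner x y + cinner x z"
    unfolding cinner_ell2_def
    by (simp add: ell2_nth_simps distrib_left suminf_add[symmetric] summable_cnj_mult_ell2)
  show "cinner x (a *\<^sub>C y) = a * cinner x y"
    unfolding cinner_ell2_def
    by (simp add: ell2_nth_simps suminf_mult[symmetric] summable_cnj_mult_ell2 mult.left_commute)
  have "cinner x x = (\<Sum>n. complex_of_real ((cmod (ell2_nth x n))\<^sup>2))"
    unfolding cinner_ell2_def by (simp only: complex_norm_square mult.commute)
  also have "\<dots> = complex_of_real (\<Sum>n. (cmod (ell2_nth x n))\<^sup>2)"
    by (rule suminf_of_real[OF summable_ell2, symmetric])
  finally show "cinner x x = complex_of_real ((norm x)\<^sup>2)"
    unfolding norm_ell2.rep_eq by (simp add: suminf_nonneg summable_ell2)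
qed

end


section \<open>The Cuntz algebra\<close>

text \<open>
  The number of generators is \<open>N = CARD('n)\<close>.  A family \<open>T\<close> of operators satisfies the
  Cuntz relations if \<open>T\<^sub>i\<^sup>* T\<^sub>j = \<delta>\<^sub>i\<^sub>j I\<close> and \<open>\<Sum>\<^sub>i T\<^sub>i T\<^sub>i\<^sup>* = I\<close>.
\<close>

definition cuntz_family :: "('n::finite \<Rightarrow> 'h::chilbert_space \<Rightarrow> 'h) \<Rightarrow> bool" where
  "cuntz_family T \<longleftrightarrow>
     (\<forall>i. bounded_clinear (T i)) \<and>
     (\<exists>T'. (\<forall>i. bounded_clinear (T' i) \<and> is_adjoint (T' i) (T i)) \<and>
           (\<forall>i j x. T' i (T j x) = (if i = j then x else 0)) \<and>
           (\<forall>x. (\<Sum>i\<in>UNIV. T i (T' i x)) = x))"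

inductive_set star_subalgebra_gen :: "('n \<Rightarrow> 'a::cstar_algebra_1) \<Rightarrow> 'a set"
  for s :: "'n \<Rightarrow> 'a" where
  gen: "s i \<in> star_subalgebra_gen s"
| one: "1 \<in> star_subalgebra_gen s"
| add: "a \<in> star_subalgebra_gen s \<Longrightarrow> b \<in> star_subalgebra_gen s \<Longrightarrow> a + b \<in> star_subalgebra_gen s"
| scale: "a \<in> star_subalgebra_gen s \<Longrightarrow> c *\<^sub>C a \<in> star_subalgebra_gen s"
| mult: "a \<in> star_subalgebra_gen s \<Longrightarrow> b \<in> star_subalgebra_gen s \<Longrightarrow> a * b \<in> star_subalgebra_gen s"
| star: "a \<in> star_subalgebra_gen s \<Longrightarrow> star a \<in> star_subalgebra_gen s"

text \<open>
  The type \<open>'a\<close> with generators \<open>s\<close> is the universal C*-algebra of the Cuntz relations.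
  HOL cannot quantify over all Hilbert spaces inside a formula, so the universal property is
  stated for families on \<open>ell2\<close>.  This loses nothing: a Cuntz family on any Hilbert space is a
  direct sum of families on separable subspaces (its cyclic subspaces), and for \<open>N \<ge> 2\<close>
  each nonzero one of these is infinite-dimensional, hence unitarily equivalent to \<open>ell2\<close>.
\<close>

definition cuntz_algebra :: "('n::finite \<Rightarrow> 'a::cstar_algebra_1) \<Rightarrow> bool" where
  "cuntz_algebra s \<longleftrightarrow>
     (\<forall>i j. star (s i) * s j = (if i = j then 1 else 0)) \<and>
     (\<Sum>i\<in>UNIV. s i * star (s i)) = 1 \<and>
     closure (star_subalgebra_gen s) = UNIV \<and>
     (\<forall>T :: 'n \<Rightarrow> ell2 \<Rightarrow> ell2. cuntz_family T \<longrightarrow>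
        (\<exists>!\<pi> :: 'a \<Rightarrow> ell2 \<Rightarrow> ell2. representation \<pi> \<and> (\<forall>i. \<pi> (s i) = T i)))"


section \<open>Parameters\<close>

text \<open>
  An element of the tensor algebra over \<open>\<complex>\<^sup>N\<close> is given by its coordinates with respect to the
  basis \<open>e\<^sub>w = e\<^sub>w\<^sub>1 \<otimes> \<dots> \<otimes> e\<^sub>w\<^sub>k\<close>, where \<open>w\<close> ranges over the words in the index type.  A tensor
  of degree \<open>k\<close> vanishes on all words of length other than \<open>k\<close>.  In particular, nonzero
  tensors of different degrees are different.
\<close>

type_synonym 'n tensor = "'n list \<Rightarrow> complex"

definition tensor_one :: "'n tensor" where
  "tensor_one w = (if w = [] then 1 else 0)"

definition tensor_vec :: "complex ^ 'n \<Rightarrow> 'n tensor" where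
  "tensor_vec v w = (case w of [i] \<Rightarrow> v $ i | _ \<Rightarrow> 0)"

definition tensor_mult :: "'n tensor \<Rightarrow> 'n tensor \<Rightarrow> 'n tensor"  (infixr \<open>\<otimes>\<^sub>t\<close> 70) where
  "(f \<otimes>\<^sub>t g) w = (\<Sum>k\<le>length w. f (take k w) * g (drop k w))"

definition pure_tensor :: "(complex ^ 'n) list \<Rightarrow> 'n tensor" where
  "pure_tensor zs = foldr (\<lambda>v t. tensor_vec v \<otimes>\<^sub>t t) zs tensor_one"

primrec tensor_power :: "'n tensor \<Rightarrow> nat \<Rightarrow> 'n tensor" where
  "tensor_power y 0 = tensor_one"
| "tensor_power y (Suc p) = y \<otimes>\<^sub>t tensor_power y p"

definition sphere_tensors_deg :: "nat \<Rightarrow> ('n::finite) tensor set" where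
  "sphere_tensors_deg k = {pure_tensor zs | zs. length zs = k \<and> set zs \<subseteq> sphere 0 1}"

text \<open>
  The coproduct over \<open>k \<ge> 1\<close> is a union here, because the summands are pairwise disjoint.
\<close>

definition sphere_tensors :: "('n::finite) tensor set" where
  "sphere_tensors = (\<Union>k\<in>{1..}. sphere_tensors_deg k)"

definition periodic :: "('n::finite) tensor \<Rightarrow> bool" where
  "periodic z \<longleftrightarrow>
     (\<exists>l\<ge>1. \<exists>y\<in>sphere_tensors_deg l. \<exists>p\<ge>2. z = tensor_power y p)"

definition vec_cinner :: "complex ^ 'n \<Rightarrow> complex ^ 'n \<Rightarrow> complex" where
  "vec_cinner z w = (\<Sum>i\<in>UNIV. cnj (z $ i) * w $ i)"

definition asymptotically_periodic :: "(nat \<Rightarrow> complex ^ 'n::finite) \<Rightarrow> bool" where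
  "asymptotically_periodic z \<longleftrightarrow>
     (\<exists>p>0. summable (\<lambda>n. 1 - cmod (vec_cinner (z n) (z (n + p)))))"


section \<open>The representations GP(z)\<close>

definition orthonormal_family :: "'i set \<Rightarrow> ('i \<Rightarrow> 'h::chilbert_space) \<Rightarrow> bool" where
  "orthonormal_family I v \<longleftrightarrow> (\<forall>i\<in>I. \<forall>j\<in>I. cinner (v i) (v j) = (if i = j then 1 else 0))"

definition s_vec :: "('n::finite \<Rightarrow> 'a::cstar_algebra_1) \<Rightarrow> complex ^ 'n \<Rightarrow> 'a" where
  "s_vec s z = (\<Sum>i\<in>UNIV. z $ i *\<^sub>C s i)"

definition s_prod :: "('n::finite \<Rightarrow> 'a::cstar_algebra_1) \<Rightarrow> (complex ^ 'n) list \<Rightarrow> 'a" where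
  "s_prod s zs = prod_list (map (s_vec s) zs)"

text \<open>
  The factorisation \<open>zs\<close> of the tensor \<open>z\<close> is unique up to phases of product 1, on which the
  condition below does not depend.
\<close>

definition GP_cycle ::
    "('n::finite \<Rightarrow> 'a::cstar_algebra_1) \<Rightarrow> ('a \<Rightarrow> 'h::chilbert_space \<Rightarrow> 'h) \<Rightarrow> 'n tensor \<Rightarrow> bool" where
  "GP_cycle s \<pi> z \<longleftrightarrow>
     (\<exists>zs \<Omega>. zs \<noteq> [] \<and> set zs \<subseteq> sphere 0 1 \<and> z = pure_tensor zs \<and>
        unit_cyclic_vector \<pi> \<Omega> \<and>
        \<pi> (s_prod s zs) \<Omega> = \<Omega> \<and>
        orthonormal_family {..<length zs} (\<lambda>i. \<pi> (s_prod s (drop i zs)) \<Omega>))"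

text \<open>
  Sequences are indexed from 0, so that \<open>z n\<close> is the \<open>(n + 1)\<close>-st term.  The \<open>n\<close>-th member of the
  family below is \<open>\<pi>(s(z n)\<^sup>* \<dots> s(z 0)\<^sup>*) \<Omega>\<close>; the vector \<open>\<Omega>\<close> itself is not a member.
\<close>

definition GP_chain ::
    "('n::finite \<Rightarrow> 'a::cstar_algebra_1) \<Rightarrow> ('a \<Rightarrow> 'h::chilbert_space \<Rightarrow> 'h) \<Rightarrow>
       (nat \<Rightarrow> complex ^ 'n) \<Rightarrow> bool" where
  "GP_chain s \<pi> z \<longleftrightarrow>
     (\<exists>\<Omega>. unit_cyclic_vector \<pi> \<Omega> \<and>
        orthonormal_family UNIV
          (\<lambda>n. \<pi> (prod_list (map (\<lambda>i. star (s_vec s (z i))) (rev [0..<Suc n]))) \<Omega>))"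

end

theory Submission
  imports Defs "HOL-Real_Asymp.Real_Asymp"
begin

text \<open>
  The defining vector of \<open>GP(z)\<close> is the member \<open>\<Omega>\<^sub>0\<close> of a family with
  \<open>\<Omega>\<^sub>n = s(z\<^sub>n) \<Omega>\<^sub>n\<^sub>+\<^sub>1\<close>, called a chain for \<open>z\<close> below; in the cyclic case \<open>z\<close> and \<open>\<Omega>\<close> are
  continued with period \<open>k\<close>.  Since \<open>s(u)\<^sup>* s(v) = \<langle>u|v\<rangle>\<close>, two chains \<open>X\<close> and \<open>Y\<close> for \<open>z\<close> satisfy
  \<open>\<langle>X\<^sub>n|Y\<^sub>m\<rangle> = \<Prod>\<^sub>t\<^sub><\<^sub>T \<langle>z\<^sub>n\<^sub>+\<^sub>t|z\<^sub>m\<^sub>+\<^sub>t\<rangle> \<langle>X\<^sub>n\<^sub>+\<^sub>T|Y\<^sub>m\<^sub>+\<^sub>T\<rangle>\<close> (\<open>chain_cinner\<close>), and if all these numbers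
  vanish, then \<open>X\<close> and \<open>Y\<close> generate orthogonal subspaces (\<open>chain_orthogonal_imp_disjoint\<close>).

  Irreducibility.  Let \<open>P\<close> be the projection onto an invariant subspace.  Then \<open>P \<Omega>\<^sub>n\<close> is a chain for
  \<open>z\<close> as well.  If \<open>\<Sum>\<^sub>t (1 - \<bar>\<langle>z\<^sub>n\<^sub>+\<^sub>t|z\<^sub>m\<^sub>+\<^sub>t\<rangle>\<bar>)\<close> diverges, the product tends to 0 and
  \<open>\<langle>\<Omega>\<^sub>n|P \<Omega>\<^sub>m\<rangle> = 0\<close>.  When this happens whenever \<open>\<Omega>\<^sub>n \<noteq> \<Omega>\<^sub>m\<close>, the vector \<open>P \<Omega>\<^sub>0\<close> must be a multiple of
  \<open>\<Omega>\<^sub>0\<close>, and cyclicity makes the subspace trivial (\<open>irreducible_if_shifts_not_asymptotic\<close>).  For an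
  infinite chain the divergence is exactly the failure of asymptotic periodicity.  For a
  \<open>k\<close>-periodic sequence convergence means that a shift by \<open>q\<close>, not divisible by \<open>k\<close>, changes only
  phases; then so does the shift by \<open>gcd q k\<close>, and the tensor is a power.

  Reducibility.  It suffices to find two nonzero chains for \<open>z\<close> that are orthogonal
  (\<open>reducible_if_orthogonal_chains\<close>).  In both cases the commutant contains a unitary \<open>T\<close> that
  shifts the chain by the period, and the two chains are functions of \<open>T\<close> with disjoint supports
  applied to one chain.  For a cycle with \<open>z = y\<^sup>\<otimes>\<^sup>p\<close> the shift has order \<open>p\<close>, and
  two eigenvectors do.  For an infinite chain with asymptotic period \<open>p\<close> the shifted chain
  \<open>\<Omega>\<^sub>n\<^sub>+\<^sub>p\<^sub>j\<close> is only asymptotically a chain for \<open>z\<close>, but it converges to a true one \<open>\<xi>\<^sub>j\<close> for every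
  integer \<open>j\<close> (\<open>asymptotic_chain_exists\<close>).  The \<open>\<xi>\<^sub>j\<close> are orthonormal, so \<open>T\<close> is a bilateral shift
  without eigenvectors in their span; the supports are taken to be two half circles, whose indicator
  functions are \<open>(1 \<plusminus> w) / 2\<close> for a square wave \<open>w\<close> (\<open>square_wave_orthogonal\<close>).
\<close>

section \<open>Complex inner product spaces\<close>

lemma scaleC_zero_left [simp]: "0 *\<^sub>C x = 0" for x :: "'a::complex_vector"
  using scaleC_add_left[of 0 0 x] by simp

lemma scaleC_zero_right [simp]: "c *\<^sub>C 0 = (0 :: 'a::complex_vector)"
  using scaleC_add_right[of c 0 "0::'a"] by simp

lemma scaleC_one [simp]: "1 *\<^sub>C x = x" for x :: "'a::complex_vector"
  using scaleR_scaleC[of 1 x] by simp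

lemma scaleC_minus_right: "c *\<^sub>C (- x) = - (c *\<^sub>C x)" for x :: "'a::complex_vector"
  using scaleC_add_right[of c x "- x"] by (simp add: eq_neg_iff_add_eq_0 add.commute)

lemma scaleC_minus_left: "(- c) *\<^sub>C x = - (c *\<^sub>C x)" for x :: "'a::complex_vector"
  using scaleC_add_left[of c "- c" x] by (simp add: eq_neg_iff_add_eq_0 add.commute)

lemma scaleC_diff_right: "c *\<^sub>C (x - y) = c *\<^sub>C x - c *\<^sub>C y" for x :: "'a::complex_vector"
  using scaleC_add_right[of c x "- y"] by (simp add: scaleC_minus_right)

lemma scaleC_sum_right: "c *\<^sub>C (\<Sum>i\<in>I. f i) = (\<Sum>i\<in>I. c *\<^sub>C f i)"
  for f :: "'i \<Rightarrow> 'a::complex_vector"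
  by (induction I rule: infinite_finite_induct) (simp_all add: scaleC_add_right)

lemma scaleC_sum_left: "(\<Sum>i\<in>I. f i) *\<^sub>C x = (\<Sum>i\<in>I. f i *\<^sub>C x)"
  for x :: "'a::complex_vector"
  by (induction I rule: infinite_finite_induct) (simp_all add: scaleC_add_left)

lemma cinner_zero_right [simp]: "cinner x 0 = 0"
  using cinner_scaleC_right[of x 0 0] by simp

lemma cinner_minus_right: "cinner x (- y) = - cinner x y"
  using cinner_scaleC_right[of x "-1" y] by (simp add: scaleC_minus_left)

lemma cinner_diff_right: "cinner x (y - z) = cinner x y - cinner x z"
  using cinner_add_right[of x y "- z"] by (simp add: cinner_minus_right)

lemma cinner_sum_right: "cinner x (\<Sum>i\<in>I. f i) = (\<Sum>i\<in>I. cinner x (f i))"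
  by (induction I rule: infinite_finite_induct) (simp_all add: cinner_add_right)

lemma cinner_scaleR_right: "cinner x (r *\<^sub>R y) = of_real r * cinner x y"
  by (simp add: scaleR_scaleC cinner_scaleC_right)

lemma cinner_zero_left [simp]: "cinner 0 x = 0"
  by (subst cinner_commute) simp

lemma cinner_add_left: "cinner (x + y) z = cinner x z + cinner y z"
  by (subst (1 2 3) cinner_commute) (simp add: cinner_add_right)

lemma cinner_diff_left: "cinner (x - y) z = cinner x z - cinner y z"
  by (subst (1 2 3) cinner_commute) (simp add: cinner_diff_right)

lemma cinner_scaleC_left: "cinner (c *\<^sub>C x) y = cnj c * cinner x y"
  by (subst (1 2) cinner_commute) (simp add: cinner_scaleC_right)

lemma cinner_sum_left: "cinner (\<Sum>i\<in>I. f i) x = (\<Sum>i\<in>I. cinner (f i) x)"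
  by (induction I rule: infinite_finite_induct) (simp_all add: cinner_add_left)

lemma cinner_eq_zero_iff: "cinner x x = 0 \<longleftrightarrow> x = 0"
  by (simp add: cinner_self)

lemma norm_eq_one_iff: "norm x = 1 \<longleftrightarrow> cinner x x = 1"
proof
  assume "cinner x x = 1"
  then have "complex_of_real ((norm x)\<^sup>2) = complex_of_real 1" by (simp add: cinner_self)
  then have "(norm x)\<^sup>2 = 1" using of_real_eq_iff by blast
  then show "norm x = 1" using norm_ge_zero[of x] by (simp add: power2_eq_1_iff)
qed (simp add: cinner_self)

lemma norm_scaleC_chilbert: "norm (c *\<^sub>C (x::'a::chilbert_space)) = cmod c * norm x"
proof -
  have "complex_of_real ((norm (c *\<^sub>C x))\<^sup>2) = cinner (c *\<^sub>C x) (c *\<^sub>C x)"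
    by (simp add: cinner_self)
  also have "\<dots> = complex_of_real ((cmod c)\<^sup>2) * cinner x x"
    by (simp add: cinner_scaleC_left cinner_scaleC_right complex_norm_square mult_ac
        del: of_real_power)
  also have "\<dots> = complex_of_real ((cmod c * norm x)\<^sup>2)"
    by (simp add: cinner_self power_mult_distrib)
  finally have "(norm (c *\<^sub>C x))\<^sup>2 = (cmod c * norm x)\<^sup>2" using of_real_eq_iff by blast
  then show ?thesis by (simp add: power2_eq_iff_nonneg)
qed

lemma norm_diff_square:
  "(norm (x - y))\<^sup>2 = (norm x)\<^sup>2 - 2 * Re (cinner x y) + (norm (y::'a::chilbert_space))\<^sup>2"
proof -
  have "complex_of_real ((norm (x - y))\<^sup>2) = cinner (x - y) (x - y)"
    by (simp add: cinner_self)
  also have "\<dots> = of_real ((norm x)\<^sup>2) - (cinner x y + cnj (cinner x y)) + of_real ((norm y)\<^sup>2)"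
    unfolding cinner_diff_left cinner_diff_right cinner_commute[of y x] by (simp add: cinner_self)
  also have "\<dots> = of_real ((norm x)\<^sup>2 - 2 * Re (cinner x y) + (norm y)\<^sup>2)"
    by (simp add: complex_add_cnj)
  finally show ?thesis using of_real_eq_iff by blast
qed

lemma norm_add_square:
  "(norm (x + y))\<^sup>2 = (norm x)\<^sup>2 + 2 * Re (cinner x y) + (norm (y::'a::chilbert_space))\<^sup>2"
  using norm_diff_square[of x "- y"] by (simp add: cinner_minus_right)

lemma norm_sub_projection_square:
  fixes x y :: "'a::chilbert_space"
  assumes "norm y = 1"
  shows "(norm (x - cinner y x *\<^sub>C y))\<^sup>2 = (norm x)\<^sup>2 - (cmod (cinner y x))\<^sup>2"
proof -
  have "cinner x (cinner y x *\<^sub>C y) = of_real ((cmod (cinner y x))\<^sup>2)"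
    by (simp add: cinner_scaleC_right cinner_commute[of x y] complex_norm_square[symmetric]
          del: of_real_power)
  then show ?thesis
    by (simp add: norm_diff_square norm_scaleC_chilbert assms)
qed

lemma Cauchy_Schwarz_cinner:
  fixes x y :: "'a::chilbert_space"
  shows "cmod (cinner x y) \<le> norm x * norm y"
proof (cases "x = 0")
  case False
  define u where "u = complex_of_real (inverse (norm x)) *\<^sub>C x"
  have u: "norm u = 1" using False by (simp add: u_def norm_scaleC_chilbert norm_inverse)
  have "(cmod (cinner u y))\<^sup>2 \<le> (norm y)\<^sup>2"
    using norm_sub_projection_square[OF u, of y] zero_le_power2[of "norm (y - cinner u y *\<^sub>C u)"]
    by linarith
  then have "cmod (cinner u y) \<le> norm y" by (rule power2_le_imp_le) simp
  moreover have "cmod (cinner u y) = cmod (cinner x y) / norm x"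
    by (simp add: u_def cinner_scaleC_left norm_mult norm_inverse divide_inverse mult.commute)
  ultimately show ?thesis using False by (simp add: field_simps)
qed simp

lemma cinner_unit_eq_imp_proportional:
  fixes x y :: "'a::chilbert_space"
  assumes "norm x = 1" "norm y = 1" "cmod (cinner y x) = 1"
  shows "x = cinner y x *\<^sub>C y"
  using norm_sub_projection_square[OF assms(2), of x] assms by simp

text \<open>
  For unit vectors \<open>\<bar>1 - \<langle>u|v\<rangle>\<bar>\<close> behaves like a squared distance: its real part is
  \<open>\<parallel>u - v\<parallel>\<^sup>2 / 2\<close>.  It therefore satisfies a triangle inequality up to a factor 2.  What makes
  the phase of \<open>\<langle>u|w\<rangle>\<close> harmless is that the error \<open>\<langle>v - u|w - v\<rangle>\<close> is of second order.
\<close>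

lemma one_minus_cinner_quasi_triangle:
  fixes u v w :: "'a::chilbert_space"
  assumes "norm u = 1" "norm v = 1" "norm w = 1"
  shows "cmod (1 - cinner u w) \<le> 2 * (cmod (1 - cinner u v) + cmod (1 - cinner v w))"
proof -
  have v: "cinner v v = 1" using assms by (simp add: cinner_self)
  have eq: "1 - cinner u w = (1 - cinner u v) + (1 - cinner v w) + cinner (v - u) (w - v)"
    by (simp add: cinner_diff_left cinner_diff_right v)
  have sq: "(norm (a - b))\<^sup>2 \<le> 2 * cmod (1 - cinner a b)"
    if "norm a = 1" "norm b = 1" for a b :: 'a
    using complex_Re_le_cmod[of "1 - cinner a b"] by (simp add: norm_diff_square that)
  have "cmod (cinner (v - u) (w - v)) \<le> norm (u - v) * norm (v - w)"
    using Cauchy_Schwarz_cinner[of "v - u" "w - v"] by (simp add: norm_minus_commute)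
  also have "\<dots> \<le> ((norm (u - v))\<^sup>2 + (norm (v - w))\<^sup>2) / 2"
    using sum_squares_bound[of "norm (u - v)" "norm (v - w)"] by simp
  also have "\<dots> \<le> cmod (1 - cinner u v) + cmod (1 - cinner v w)"
    using sq[OF assms(1,2)] sq[OF assms(2,3)] by simp
  finally have "cmod (cinner (v - u) (w - v)) \<le> cmod (1 - cinner u v) + cmod (1 - cinner v w)" .
  moreover have "cmod (1 - cinner u w)
      \<le> cmod (1 - cinner u v) + cmod (1 - cinner v w) + cmod (cinner (v - u) (w - v))"
    unfolding eq by (meson add_mono norm_triangle_ineq norm_triangle_le order_refl)
  ultimately show ?thesis by simp
qed

lemma bounded_linear_cinner_right: "bounded_linear (cinner (x::'a::chilbert_space))"
proof (rule bounded_linear_intro)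
  show "norm (cinner x y) \<le> norm y * norm x" for y
    using Cauchy_Schwarz_cinner[of x y] by (simp add: mult.commute)
qed (simp_all add: cinner_add_right cinner_scaleR_right scaleR_conv_of_real)

lemma bounded_linear_cinner_left: "bounded_linear (\<lambda>x. cinner x (y::'a::chilbert_space))"
proof (rule bounded_linear_intro)
  show "norm (cinner x y) \<le> norm x * norm y" for x
    using Cauchy_Schwarz_cinner[of x y] .
  show "cinner (r *\<^sub>R x) y = r *\<^sub>R cinner x y" for r x
    by (simp add: scaleR_scaleC cinner_scaleC_left scaleR_conv_of_real)
qed (simp_all add: cinner_add_left)

subsection \<open>Coordinate spaces\<close>

text \<open>
  As Hilbert spaces, \<open>\<complex>\<close> and \<open>\<complex>\<^sup>N\<close> come under all of the above; the inner product on the latter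
  is the pairing of parameters.
\<close>

instantiation complex :: chilbert_space
begin

definition scaleC_complex :: "complex \<Rightarrow> complex \<Rightarrow> complex" where "scaleC_complex = (*)"
definition cinner_complex :: "complex \<Rightarrow> complex \<Rightarrow> complex" where "cinner_complex x y = cnj x * y"

instance
  by standard (simp_all add: scaleC_complex_def cinner_complex_def algebra_simps
      scaleR_conv_of_real complex_norm_square del: of_real_power)

end

instantiation vec :: (chilbert_space, finite) chilbert_space
begin

definition scaleC_vec :: "complex \<Rightarrow> 'a ^ 'b \<Rightarrow> 'a ^ 'b" where
  "scaleC_vec c x = (\<chi> i. c *\<^sub>C x $ i)"
definition cinner_vec :: "'a ^ 'b \<Rightarrow> 'a ^ 'b \<Rightarrow> complex" where
  "cinner_vec x y = (\<Sum>i\<in>UNIV. cinner (x $ i) (y $ i))"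

instance
proof
  fix x y z :: "'a ^ 'b" and a b :: complex and r :: real
  show "a *\<^sub>C (x + y) = a *\<^sub>C x + a *\<^sub>C y" "(a + b) *\<^sub>C x = a *\<^sub>C x + b *\<^sub>C x"
    "a *\<^sub>C (b *\<^sub>C x) = (a * b) *\<^sub>C x" "r *\<^sub>R x = complex_of_real r *\<^sub>C x"
    by (simp_all add: scaleC_vec_def vec_eq_iff scaleC_add_right scaleC_add_left scaleC_scaleC
        scaleR_scaleC)
  show "cinner x y = cnj (cinner y x)"
    unfolding cinner_vec_def cnj_sum by (rule sum.cong[OF refl cinner_commute])
  show "cinner x (y + z) = cinner x y + cinner x z"
    by (simp add: cinner_vec_def cinner_add_right sum.distrib)
  show "cinner x (a *\<^sub>C y) = a * cinner x y"
    by (simp add: cinner_vec_def scaleC_vec_def cinner_scaleC_right sum_distrib_left)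
  show "cinner x x = complex_of_real ((norm x)\<^sup>2)"
    by (simp add: cinner_vec_def cinner_self norm_vec_def L2_set_def sum_nonneg)
qed

end

lemma vec_cinner_eq_cinner: "vec_cinner = cinner"
  by (intro ext) (simp add: vec_cinner_def cinner_vec_def cinner_complex_def)

lemma scaleC_vec_nth [simp]: "(c *\<^sub>C v) $ i = c * v $ i" for v :: "complex ^ 'n"
  by (simp add: scaleC_vec_def scaleC_complex_def)

lemma cmod_vec_cinner_le_one:
  "norm u = 1 \<Longrightarrow> norm v = 1 \<Longrightarrow> cmod (vec_cinner u v) \<le> 1"
  using Cauchy_Schwarz_cinner[of u v] by (simp add: vec_cinner_eq_cinner)

subsection \<open>Orthogonal projection\<close>

lemma orthogonal_projection_exists:
  fixes K :: "'a::chilbert_space set"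
  assumes cl: "closed K" and zero: "0 \<in> K"
    and add: "\<And>x y. x \<in> K \<Longrightarrow> y \<in> K \<Longrightarrow> x + y \<in> K"
    and scale: "\<And>c x. x \<in> K \<Longrightarrow> c *\<^sub>C x \<in> K"
  shows "\<exists>y\<in>K. \<forall>k\<in>K. cinner k (x - y) = 0"
proof -
  define d where "d = (INF k\<in>K. (norm (x - k))\<^sup>2)"
  have bdd: "bdd_below ((\<lambda>k. (norm (x - k))\<^sup>2) ` K)" by (rule bdd_belowI[of _ 0]) auto
  have d_le: "d \<le> (norm (x - k))\<^sup>2" if "k \<in> K" for k
    unfolding d_def by (rule cINF_lower[OF bdd that])
  have "\<exists>k\<in>K. (norm (x - k))\<^sup>2 < d + 1 / Suc n" for n
  proof -
    have "d < d + 1 / Suc n" by simp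
    then show ?thesis unfolding d_def using cINF_less_iff[OF _ bdd] zero by blast
  qed
  then obtain k where kK: "\<And>n. k n \<in> K" and k: "\<And>n. (norm (x - k n))\<^sup>2 < d + 1 / Suc n"
    by metis
  have half: "(1 / 2 :: complex) *\<^sub>C (v + v) = v" for v :: 'a
    using scaleC_add_left[of "1 / 2" "1 / 2" v] by (simp add: scaleC_add_right)
  have near: "(norm (k n - k m))\<^sup>2 < 2 / Suc n + 2 / Suc m" for n m
  proof -
    have "k n - k m = (x - k m) - (x - k n)" by simp
    then have sub: "(norm (k n - k m))\<^sup>2 = (norm (x - k m))\<^sup>2 - 2 * Re (cinner (x - k m) (x - k n))
        + (norm (x - k n))\<^sup>2" by (simp only: norm_diff_square)
    have mid: "(1 / 2 :: complex) *\<^sub>C (k n + k m) \<in> K" by (intro scale add kK)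
    have "(x - k m) + (x - k n) = (x + x) - (k n + k m)" by simp
    also have "\<dots> = 2 *\<^sub>C (x - (1 / 2 :: complex) *\<^sub>C (k n + k m))"
      using scaleC_add_left[of 1 1 x] by (simp add: scaleC_diff_right scaleC_scaleC)
    finally have "(norm ((x - k m) + (x - k n)))\<^sup>2 \<ge> 4 * d"
      using d_le[OF mid] by (simp add: norm_scaleC_chilbert power_mult_distrib)
    then have "4 * d \<le> (norm (x - k m))\<^sup>2 + 2 * Re (cinner (x - k m) (x - k n)) + (norm (x - k n))\<^sup>2"
      by (simp only: norm_add_square)
    moreover have "2 / real (Suc j) = 2 * (1 / real (Suc j))" for j by simp
    ultimately show ?thesis using sub k[of n] k[of m] by linarith
  qed
  have "Cauchy k"
  proof (rule metric_CauchyI)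
    fix e :: real assume e: "e > 0"
    obtain M where M: "4 / e\<^sup>2 < real M" using reals_Archimedean2 by blast
    have "dist (k m) (k n) < e" if "m \<ge> M" "n \<ge> M" for m n
    proof -
      have le: "2 / Suc j < e\<^sup>2 / 2" if "j \<ge> M" for j
      proof -
        have "4 / e\<^sup>2 < real (Suc j)" using M that by simp
        then show ?thesis using e by (simp add: field_simps)
      qed
      have "(norm (k m - k n))\<^sup>2 < e\<^sup>2" using near[of m n] le[OF that(1)] le[OF that(2)] by linarith
      then show ?thesis using e by (simp add: dist_norm power2_less_imp_less)
    qed
    then show "\<exists>M. \<forall>m\<ge>M. \<forall>n\<ge>M. dist (k m) (k n) < e" by blast
  qed
  then obtain y where y: "k \<longlonglongrightarrow> y" using Cauchy_convergent_iff convergent_def by blast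
  have yK: "y \<in> K" using closed_sequentially[OF cl kK y] .
  have "(norm (x - y))\<^sup>2 \<le> d"
  proof (rule LIMSEQ_le)
    show "(\<lambda>n. (norm (x - k n))\<^sup>2) \<longlonglongrightarrow> (norm (x - y))\<^sup>2" by (intro tendsto_intros y)
    have "(\<lambda>n. d + inverse (real (Suc n))) \<longlonglongrightarrow> d + 0"
      by (intro tendsto_intros LIMSEQ_inverse_real_of_nat)
    then show "(\<lambda>n. d + 1 / real (Suc n)) \<longlonglongrightarrow> d" by (simp add: divide_inverse)
    show "\<exists>N. \<forall>n\<ge>N. (norm (x - k n))\<^sup>2 \<le> d + 1 / real (Suc n)" using k less_imp_le by blast
  qed
  then have min: "(norm (x - y))\<^sup>2 \<le> (norm (x - v))\<^sup>2" if "v \<in> K" for v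
    using d_le[OF that] by linarith
  have "cinner v (x - y) = 0" if v: "v \<in> K" for v
  proof (cases "v = 0")
    case False
    define u where "u = complex_of_real (inverse (norm v)) *\<^sub>C v"
    have u: "norm u = 1" using False by (simp add: u_def norm_scaleC_chilbert norm_inverse)
    \<comment> \<open>Moving from \<open>y\<close> by the component of \<open>x - y\<close> along \<open>u\<close> would decrease the distance.\<close>
    have "y + cinner u (x - y) *\<^sub>C u \<in> K" unfolding u_def by (intro add scale yK v)
    from min[OF this] have "(norm (x - y))\<^sup>2 \<le> (norm (x - y - cinner u (x - y) *\<^sub>C u))\<^sup>2"
      by (simp only: diff_diff_eq)
    with norm_sub_projection_square[OF u, of "x - y"]
    have "(cmod (cinner u (x - y)))\<^sup>2 \<le> 0" by linarith
    then have "cinner u (x - y) = 0" by simp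
    then show ?thesis using False by (simp add: u_def cinner_scaleC_left)
  qed simp
  then show ?thesis using yK by blast
qed

section \<open>Representations of C*-algebras are contractive\<close>

lemma star_one: "star (1 :: 'a::cstar_algebra_1) = 1"
  using star_mult[of "star (1::'a)" 1] by (simp add: star_star)

lemma star_minus: "star (- x) = - star (x :: 'a::cstar_algebra_1)"
  using star_scaleC[of "-1" x] by (simp add: scaleC_minus_left)

lemma star_diff: "star (x - y) = star x - star (y :: 'a::cstar_algebra_1)"
  using star_add[of x "- y"] by (simp add: star_minus)

lemma star_scaleR: "star (r *\<^sub>R x) = r *\<^sub>R star (x :: 'a::cstar_algebra_1)"
  by (simp add: scaleR_scaleC star_scaleC)

lemma star_zero: "star 0 = (0 :: 'a::cstar_algebra_1)"
  using star_scaleR[of 0] by simp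

lemma star_sum: "star (\<Sum>i\<in>I. f i) = (\<Sum>i\<in>I. star (f i :: 'a::cstar_algebra_1))"
  by (induction I rule: infinite_finite_induct) (simp_all add: star_add star_zero)

lemma norm_star: "norm (star x) = norm (x :: 'a::cstar_algebra_1)"
proof -
  have le: "norm y \<le> norm (star y)" for y :: 'a
  proof (cases "y = 0")
    case False
    have "norm y * norm y \<le> norm (star y) * norm y"
      using norm_mult_ineq[of "star y" y] by (simp add: norm_star_mult power2_eq_square)
    then show ?thesis using False by simp
  qed simp
  show ?thesis using le[of x] le[of "star x"] by (simp add: star_star)
qed

lemma bounded_linear_star: "bounded_linear (star :: 'a::cstar_algebra_1 \<Rightarrow> 'a)"
  by (rule bounded_linear_intro[of _ 1]) (simp_all add: star_add star_scaleR norm_star)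

text \<open>
  The square root of \<open>1 - h\<close> is found as \<open>1 - c\<close>, where \<open>c\<close> is the fixed point of
  \<open>c \<mapsto> (h + c\<^sup>2) / 2\<close>.  This map is a contraction of the ball of radius \<open>\<parallel>h\<parallel>\<close> and preserves
  self-adjointness.
\<close>

lemma self_adjoint_sqrt_one_minus:
  fixes h :: "'a::cstar_algebra_1"
  assumes sa: "star h = h" and h: "norm h < 1"
  shows "\<exists>b. star b = b \<and> b * b = 1 - h"
proof -
  define f where "f c = (1 / 2) *\<^sub>R (h + c * c)" for c :: 'a
  define B where "B = {c::'a. norm c \<le> norm h \<and> star c = c}"
  have "closed B"
    unfolding B_def
    by (intro closed_Collect_conj closed_Collect_le closed_Collect_eq continuous_intros
        bounded_linear.continuous_on[OF bounded_linear_star])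
  then have B: "complete B" by (simp add: complete_eq_closed)
  have fB: "f ` B \<subseteq> B"
  proof
    fix y assume "y \<in> f ` B"
    then obtain c where c: "norm c \<le> norm h" "star c = c" and y: "y = f c" by (auto simp: B_def)
    have "norm c * norm c \<le> norm h * 1" using c h by (intro mult_mono) auto
    then have "norm (c * c) \<le> norm h" using norm_mult_ineq[of c c] by linarith
    then have "norm (h + c * c) \<le> 2 * norm h" using norm_triangle_ineq[of h "c * c"] by linarith
    then show "y \<in> B"
      using c by (simp add: B_def y f_def star_scaleR star_add star_mult sa)
  qed
  have lip: "dist (f c) (f d) \<le> norm h * dist c d" if "c \<in> B" "d \<in> B" for c d
  proof -
    have "f c - f d = (1 / 2) *\<^sub>R (c * (c - d) + (c - d) * d)"
      by (simp add: f_def algebra_simps)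
    then have "dist (f c) (f d) = norm (c * (c - d) + (c - d) * d) / 2" by (simp add: dist_norm)
    also have "\<dots> \<le> (norm c * norm (c - d) + norm (c - d) * norm d) / 2"
      by (intro divide_right_mono norm_triangle_mono norm_mult_ineq) simp
    also have "\<dots> \<le> (norm h * norm (c - d) + norm (c - d) * norm h) / 2"
      using that by (intro divide_right_mono add_mono mult_right_mono mult_left_mono) (auto simp: B_def)
    finally show ?thesis by (simp add: dist_norm mult.commute)
  qed
  have "B \<noteq> {}" using sa by (auto simp: B_def)
  from Banach_fix[OF B this norm_ge_zero h fB lip] obtain c where c: "c \<in> B" "f c = c"
    by blast
  have "2 *\<^sub>R c = 2 *\<^sub>R f c" by (simp only: c(2))
  then have "2 *\<^sub>R c = h + c * c" by (simp add: f_def)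
  then have "(1 - c) * (1 - c) = 1 - h" by (simp add: algebra_simps scaleR_2)
  moreover have "star (1 - c) = 1 - c" using c(1) by (simp add: B_def star_diff star_one)
  ultimately show ?thesis by blast
qed

locale cstar_representation =
  fixes \<pi> :: "'a::cstar_algebra_1 \<Rightarrow> 'h::chilbert_space \<Rightarrow> 'h"
  assumes rep: "representation \<pi>"
begin

lemma rep_bounded_linear: "bounded_linear (\<pi> a)"
  using rep by (simp add: representation_def bounded_clinear_def)

lemma rep_scaleC_right: "\<pi> a (c *\<^sub>C x) = c *\<^sub>C \<pi> a x"
  using rep by (simp add: representation_def bounded_clinear_def)

lemma rep_scaleC_left: "\<pi> (c *\<^sub>C a) x = c *\<^sub>C \<pi> a x"
  using rep by (simp add: representation_def)

lemma rep_add_left: "\<pi> (a + b) x = \<pi> a x + \<pi> b x"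
  using rep by (simp add: representation_def)

lemma rep_mult: "\<pi> (a * b) x = \<pi> a (\<pi> b x)"
  using rep by (simp add: representation_def)

lemma rep_one: "\<pi> 1 x = x"
  using rep by (simp add: representation_def)

lemma rep_adjoint: "cinner (\<pi> (star a) x) y = cinner x (\<pi> a y)"
  using rep by (simp add: representation_def is_adjoint_def)

lemma rep_adjoint': "cinner (\<pi> a x) y = cinner x (\<pi> (star a) y)"
  using rep_adjoint[of "star a" x y] by (simp add: star_star)

lemma rep_diff_left: "\<pi> (a - b) x = \<pi> a x - \<pi> b x"
  using rep_add_left[of "a - b" b x] by (simp add: algebra_simps)

lemma rep_adjoint_right: "cinner x (\<pi> a y) = cinner (\<pi> (star a) x) y"
  by (simp add: rep_adjoint)

lemmas rep_add_right = linear_add[OF bounded_linear.linear[OF rep_bounded_linear]]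
lemmas rep_diff_right = linear_diff[OF bounded_linear.linear[OF rep_bounded_linear]]
lemmas rep_zero_right = linear_0[OF bounded_linear.linear[OF rep_bounded_linear]]
lemmas rep_sum_right = linear_sum[OF bounded_linear.linear[OF rep_bounded_linear]]

text \<open>
  The definition of a representation does not mention continuity in the algebra element.  It
  holds because \<open>1 - a\<^sup>*a = b\<^sup>*b\<close> for \<open>\<parallel>a\<parallel> < 1\<close>, and therefore
  \<open>\<parallel>x\<parallel>\<^sup>2 - \<parallel>\<pi>(a)x\<parallel>\<^sup>2 = \<parallel>\<pi>(b)x\<parallel>\<^sup>2 \<ge> 0\<close>.
\<close>

lemma representation_contractive: "norm (\<pi> a x) \<le> norm a * norm x"
proof -
  have small: "norm (\<pi> a x) \<le> norm x" if "norm a < 1" for a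
  proof -
    have "norm (star a * a) < 1"
      using that power_less_one_iff[of "norm a" 2] by (simp add: norm_star_mult)
    moreover have "star (star a * a) = star a * a" by (simp add: star_mult star_star)
    ultimately obtain b where b: "star b = b" "b * b = 1 - star a * a"
      using self_adjoint_sqrt_one_minus by blast
    have "cinner (\<pi> b x) (\<pi> b x) = cinner x (\<pi> (1 - star a * a) x)"
      by (simp add: rep_adjoint' b(1) flip: rep_mult b(2))
    also have "\<dots> = cinner x x - cinner (\<pi> a x) (\<pi> a x)"
      by (simp add: rep_diff_left rep_one rep_mult cinner_diff_right rep_adjoint')
    finally have "complex_of_real ((norm (\<pi> b x))\<^sup>2) = of_real ((norm x)\<^sup>2 - (norm (\<pi> a x))\<^sup>2)"
      by (simp add: cinner_self)
    then have "(norm (\<pi> b x))\<^sup>2 = (norm x)\<^sup>2 - (norm (\<pi> a x))\<^sup>2" using of_real_eq_iff by blast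
    then have "(norm (\<pi> a x))\<^sup>2 \<le> (norm x)\<^sup>2" using zero_le_power2[of "norm (\<pi> b x)"] by linarith
    then show ?thesis by (rule power2_le_imp_le) simp
  qed
  have scaled: "norm (\<pi> a x) \<le> r * norm x" if r: "norm a < r" for r
  proof -
    have r0: "r > 0" using r norm_ge_zero[of a] by linarith
    have c: "cmod (complex_of_real (inverse r)) = inverse r" using r0 by (simp add: norm_inverse)
    have "norm (complex_of_real (inverse r) *\<^sub>C a) < 1"
      unfolding norm_scaleC c using r r0 by (simp add: field_simps)
    from small[OF this] have "inverse r * norm (\<pi> a x) \<le> norm x"
      unfolding rep_scaleC_left norm_scaleC_chilbert c .
    then show ?thesis using r0 by (simp add: field_simps)
  qed
  show ?thesis
  proof (rule ccontr)
    assume *: "\<not> ?thesis"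
    then have x: "norm x > 0" using rep_zero_right by (auto simp: not_le)
    then have "norm a < norm (\<pi> a x) / norm x" using * by (simp add: field_simps)
    then obtain r where "norm a < r" "r < norm (\<pi> a x) / norm x" using dense by blast
    then show False using scaled[of r] x by (simp add: field_simps)
  qed
qed

lemma rep_tendsto_left:
  assumes "f \<longlonglongrightarrow> a"
  shows "(\<lambda>n. \<pi> (f n) x) \<longlonglongrightarrow> \<pi> a x"
proof -
  have "(\<lambda>n. \<pi> (f n) x - \<pi> a x) \<longlonglongrightarrow> 0"
  proof (rule tendsto_norm_zero_cancel, rule tendsto_sandwich)
    show "\<forall>\<^sub>F n in sequentially. 0 \<le> norm (\<pi> (f n) x - \<pi> a x)" by simp
    show "\<forall>\<^sub>F n in sequentially. norm (\<pi> (f n) x - \<pi> a x) \<le> norm (f n - a) * norm x"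
      using representation_contractive[of "f n - a" x for n] by (simp add: rep_diff_left)
    show "(\<lambda>n. norm (f n - a) * norm x) \<longlonglongrightarrow> 0"
      using assms by (auto intro!: tendsto_eq_intros simp: LIM_zero_iff)
  qed simp
  then show ?thesis by (simp add: LIM_zero_iff)
qed

end

section \<open>Chains of vectors in a representation of the Cuntz algebra\<close>

lemma int_shift_invariant_imp_constant:
  fixes f :: "int \<Rightarrow> 'b"
  assumes "\<And>n. f n = f (n + 1)"
  shows "f n = f m"
proof -
  have up: "f (n + int t) = f n" for n t
  proof (induction t)
    case (Suc t)
    have "f (n + int (Suc t)) = f (n + int t + 1)" by (simp add: ac_simps)
    also have "\<dots> = f n" using Suc assms by metis
    finally show ?case .
  qed simp
  show ?thesis
  proof (cases "n \<le> m")
    case True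
    then show ?thesis using up[of n "nat (m - n)"] by simp
  next
    case False
    then show ?thesis using up[of m "nat (n - m)"] by simp
  qed
qed

text \<open>
  The bound \<open>b \<le> exp(-(1 - b))\<close> turns a lower bound for the products into an upper bound for the
  partial sums.
\<close>

lemma summable_one_minus_if_prod_bounded_below:
  fixes b :: "nat \<Rightarrow> real"
  assumes b: "\<And>t. 0 \<le> b t" "\<And>t. b t \<le> 1" and \<delta>: "\<delta> > 0" "\<And>T. \<delta> \<le> (\<Prod>t<T. b t)"
  shows "summable (\<lambda>t. 1 - b t)"
proof (rule summableI_nonneg_bounded)
  fix T
  have "\<delta> \<le> (\<Prod>t<T. b t)" by (rule \<delta>)
  also have "\<dots> \<le> (\<Prod>t<T. exp (- (1 - b t)))"
    using b exp_ge_add_one_self[of "b t - 1" for t] by (intro prod_mono) (auto simp: algebra_simps)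
  also have "\<dots> = exp (- (\<Sum>t<T. 1 - b t))" by (simp add: exp_sum sum_negf[symmetric])
  finally have "ln \<delta> \<le> ln (exp (- (\<Sum>t<T. 1 - b t)))" using \<delta>(1) by (subst ln_le_cancel_iff) auto
  then show "(\<Sum>t<T. 1 - b t) \<le> - ln \<delta>" by simp
qed (use b in simp)

locale cuntz_representation = cstar_representation \<pi>
  for \<pi> :: "'a::cstar_algebra_1 \<Rightarrow> 'h::chilbert_space \<Rightarrow> 'h" +
  fixes s :: "'n::finite \<Rightarrow> 'a"
  assumes generators_isometric: "star (s i) * s j = (if i = j then 1 else 0)"
    and generators_dense: "closure (star_subalgebra_gen s) = UNIV"
begin

abbreviation S :: "complex ^ 'n \<Rightarrow> 'h \<Rightarrow> 'h" where "S v \<equiv> \<pi> (s_vec s v)"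

text \<open>
  Every \<open>GP(z)\<close> contains vectors with \<open>X\<^sub>n = s(z\<^sup>(\<^sup>n\<^sup>)) X\<^sub>n\<^sub>+\<^sub>1\<close>.  Indices run through all integers
  so that both the cyclic case and shifts of an infinite chain are covered.
\<close>

definition chain :: "(int \<Rightarrow> complex ^ 'n) \<Rightarrow> (int \<Rightarrow> 'h) \<Rightarrow> bool" where
  "chain z X \<longleftrightarrow> (\<forall>n. X n = S (z n) (X (n + 1)))"

lemma s_vec_scaleC: "s_vec s (c *\<^sub>C v) = c *\<^sub>C s_vec s v"
  by (simp add: s_vec_def scaleC_sum_right scaleC_scaleC)

lemma star_gen_mult_s_vec: "star (s i) * s_vec s v = v $ i *\<^sub>C 1"
  by (simp add: s_vec_def sum_distrib_left scaleC_mult_right generators_isometric if_distrib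
      cong: if_cong)

lemma star_s_vec_mult_s_vec: "star (s_vec s u) * s_vec s v = vec_cinner u v *\<^sub>C 1"
proof -
  have "star (s_vec s u) * s_vec s v = (\<Sum>i\<in>UNIV. cnj (u $ i) *\<^sub>C (star (s i) * s_vec s v))"
    by (simp add: s_vec_def[of s u] star_sum star_scaleC sum_distrib_right scaleC_mult_left)
  also have "\<dots> = (\<Sum>i\<in>UNIV. (cnj (u $ i) * v $ i) *\<^sub>C 1)"
    by (simp add: star_gen_mult_s_vec scaleC_scaleC)
  also have "\<dots> = vec_cinner u v *\<^sub>C 1"
    by (simp add: vec_cinner_def scaleC_sum_left)
  finally show ?thesis .
qed

lemma cinner_S: "cinner (S u x) (S v y) = vec_cinner u v * cinner x y"
  by (simp add: rep_adjoint' star_s_vec_mult_s_vec rep_scaleC_left rep_one cinner_scaleC_right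
      flip: rep_mult)

lemma vec_cinner_self: "norm v = 1 \<Longrightarrow> vec_cinner v v = 1"
  by (simp add: vec_cinner_eq_cinner cinner_self)

lemma norm_S: "norm v = 1 \<Longrightarrow> norm (S v x) = norm x"
proof -
  assume "norm v = 1"
  then have "complex_of_real ((norm (S v x))\<^sup>2) = of_real ((norm x)\<^sup>2)"
    using cinner_S[of v x v x] by (simp only: cinner_self vec_cinner_self mult_1)
  then have "(norm (S v x))\<^sup>2 = (norm x)\<^sup>2" using of_real_eq_iff by blast
  then show ?thesis by (simp add: power2_eq_iff_nonneg)
qed

lemma chain_cinner:
  assumes "chain z X" "chain z' Y"
  shows "cinner (X n) (Y m) = (\<Prod>t<T. vec_cinner (z (n + int t)) (z' (m + int t)))
      * cinner (X (n + int T)) (Y (m + int T))"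
proof (induction T)
  case (Suc T)
  have "cinner (X (n + int T)) (Y (m + int T)) = vec_cinner (z (n + int T)) (z' (m + int T))
      * cinner (X (n + int T + 1)) (Y (m + int T + 1))"
    by (metis assms chain_def cinner_S)
  then show ?case using Suc by (simp add: algebra_simps)
qed simp

lemma chain_cinner_same_shift:
  assumes "chain z X" "chain z Y" "\<And>n. norm (z n) = 1"
  shows "cinner (X n) (Y n) = cinner (X m) (Y m)"
proof (rule int_shift_invariant_imp_constant[where f = "\<lambda>n. cinner (X n) (Y n)"])
  show "cinner (X n) (Y n) = cinner (X (n + 1)) (Y (n + 1))" for n
    using chain_cinner[OF assms(1,2), of n n 1] assms(3) by (simp add: vec_cinner_self)
qed

lemma chain_norm:
  assumes "chain z X" "\<And>n. norm (z n) = 1"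
  shows "norm (X n) = norm (X m)"
  by (rule int_shift_invariant_imp_constant[where f = "\<lambda>n. norm (X n)"])
     (metis assms chain_def norm_S)

lemma chain_diff: "chain z X \<Longrightarrow> chain z Y \<Longrightarrow> chain z (\<lambda>n. X n - Y n)"
  unfolding chain_def by (metis rep_diff_right)

lemma chain_add: "chain z X \<Longrightarrow> chain z Y \<Longrightarrow> chain z (\<lambda>n. X n + Y n)"
  unfolding chain_def by (metis rep_add_right)

lemma chain_scaleC: "chain z X \<Longrightarrow> chain z (\<lambda>n. c *\<^sub>C X n)"
  unfolding chain_def by (metis rep_scaleC_right)

lemma chain_sum: "(\<And>i. i \<in> I \<Longrightarrow> chain z (X i)) \<Longrightarrow> chain z (\<lambda>n. \<Sum>i\<in>I. X i n)"
  unfolding chain_def rep_sum_right by (intro allI sum.cong refl) blast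

lemma generator_invariant_imp_invariant:
  assumes K: "closed K" "\<And>x y. x \<in> K \<Longrightarrow> y \<in> K \<Longrightarrow> x + y \<in> K" "\<And>c x. x \<in> K \<Longrightarrow> c *\<^sub>C x \<in> K"
    and inv: "\<And>i x. x \<in> K \<Longrightarrow> \<pi> (s i) x \<in> K" "\<And>i x. x \<in> K \<Longrightarrow> \<pi> (star (s i)) x \<in> K"
    and y: "y \<in> K"
  shows "\<pi> a y \<in> K"
proof -
  have alg: "\<forall>y\<in>K. \<pi> a y \<in> K \<and> \<pi> (star a) y \<in> K" if "a \<in> star_subalgebra_gen s" for a
    using that
  proof induction
    case (gen i)
    then show ?case using inv by blast
  next
    case one
    then show ?case by (simp add: star_one rep_one)
  next
    case (add a b)
    then show ?case using K by (simp add: star_add rep_add_left)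
  next
    case (scale a c)
    then show ?case using K by (simp add: star_scaleC rep_scaleC_left)
  next
    case (mult a b)
    then show ?case by (simp add: star_mult rep_mult)
  next
    case (star a)
    then show ?case by (simp add: star_star)
  qed
  have "a \<in> closure (star_subalgebra_gen s)" by (simp add: generators_dense)
  then obtain f where f: "\<And>n. f n \<in> star_subalgebra_gen s" "f \<longlonglongrightarrow> a"
    unfolding closure_sequential by blast
  have "\<pi> (f n) y \<in> K" for n using alg[OF f(1)] y by blast
  from closed_sequentially[OF K(1) this rep_tendsto_left[OF f(2)]] show ?thesis .
qed

text \<open>
  Orthogonality of two chains as families already makes the cyclic subspaces that they generate
  orthogonal.  The vectors orthogonal to all \<open>s\<^sub>w X\<^sub>n\<close> form an invariant subspace, because
  \<open>s\<^sub>i\<^sup>* X\<^sub>n\<close> is a multiple of \<open>X\<^sub>n\<^sub>+\<^sub>1\<close>; for the same reason this subspace contains every \<open>Y\<^sub>m\<close>.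
\<close>

lemma chain_orthogonal_imp_disjoint:
  assumes X: "chain z X" and Y: "chain z Y" and orth: "\<And>n m. cinner (X n) (Y m) = 0"
  shows "cinner (X n) (\<pi> a (Y m)) = 0"
proof -
  define W where "W w = \<pi> (prod_list (map s w))" for w
  have W: "W [] x = x" "W (i # w) x = \<pi> (s i) (W w x)" for i w x
    by (simp_all add: W_def rep_one rep_mult)
  have star_chain: "\<pi> (star (s i)) (Z n) = z n $ i *\<^sub>C Z (n + 1)" if "chain z Z" for Z i n
  proof -
    have "\<pi> (star (s i)) (Z n) = \<pi> (star (s i) * s_vec s (z n)) (Z (n + 1))"
      using that by (metis chain_def rep_mult)
    then show ?thesis by (simp add: star_gen_mult_s_vec rep_scaleC_left rep_one)
  qed
  define K where "K = {y. \<forall>w n. cinner (W w (X n)) y = 0}"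
  have YK: "Y m \<in> K" for m
  proof -
    have "cinner (W w (X n)) (Y m) = 0" for w n
    proof (induction w arbitrary: m)
      case (Cons i w)
      then show ?case by (simp add: W rep_adjoint' star_chain[OF Y] cinner_scaleC_right)
    qed (simp add: W orth)
    then show ?thesis by (simp add: K_def)
  qed
  have "\<pi> a (Y m) \<in> K"
  proof (rule generator_invariant_imp_invariant[OF _ _ _ _ _ YK])
    show "closed K"
      unfolding K_def
      by (intro closed_Collect_all closed_Collect_eq continuous_on_const
          bounded_linear.continuous_on[OF bounded_linear_cinner_right continuous_on_id])
    show "\<pi> (star (s i)) y \<in> K" if "y \<in> K" for i y
    proof -
      have "cinner (W w (X n)) (\<pi> (star (s i)) y) = cinner (W (i # w) (X n)) y" for w n
        by (simp add: W rep_adjoint')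
      then show ?thesis using that by (simp add: K_def)
    qed
    show "\<pi> (s i) y \<in> K" if y: "y \<in> K" for i y
    proof -
      have "cinner (W w (X n)) (\<pi> (s i) y) = 0" for w n
      proof (cases w)
        case Nil
        have "cinner (W [] (X (n + 1))) y = 0" using y unfolding K_def by blast
        then show ?thesis
          by (simp add: Nil W rep_adjoint_right star_chain[OF X] cinner_scaleC_left)
      next
        case (Cons j w')
        have "cinner (W w' (X n)) y = 0" using y unfolding K_def by blast
        moreover have "\<pi> (star (s j)) (\<pi> (s i) y) = (if j = i then y else 0)"
          using rep_scaleC_left[of 0 0 y]
          by (simp add: generators_isometric rep_one flip: rep_mult)
        ultimately show ?thesis by (simp add: Cons W rep_adjoint')
      qed
      then show ?thesis by (simp add: K_def)
    qed
  qed (auto simp: K_def cinner_add_right cinner_scaleC_right)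
  then have "cinner (W [] (X n)) (\<pi> a (Y m)) = 0" unfolding K_def by blast
  then show ?thesis by (simp add: W)
qed

section \<open>Irreducibility and reducibility in terms of chains\<close>

lemma cyclic_vector_orthogonal_imp_zero:
  assumes cyc: "unit_cyclic_vector \<pi> \<Omega>" and y: "\<And>a. cinner (\<pi> a \<Omega>) y = 0"
  shows "y = 0"
proof -
  have "closed {x. cinner x y = 0}"
    by (intro closed_Collect_eq continuous_on_const
        bounded_linear.continuous_on[OF bounded_linear_cinner_left continuous_on_id])
  then have "closure (range (\<lambda>a. \<pi> a \<Omega>)) \<subseteq> {x. cinner x y = 0}"
    using y by (intro closure_minimal) auto
  then have "cinner y y = 0" using cyc by (auto simp: unit_cyclic_vector_def)
  then show ?thesis by (simp add: cinner_eq_zero_iff)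
qed

text \<open>
  Let \<open>P\<close> be the projection onto an invariant subspace and \<open>c = \<langle>\<Omega>\<^sub>0|P \<Omega>\<^sub>0\<rangle>\<close>.  Then
  \<open>Y\<^sub>n = P \<Omega>\<^sub>n - c \<Omega>\<^sub>n\<close> is a chain for \<open>z\<close> orthogonal to \<open>\<Omega>\<close>: for \<open>\<Omega>\<^sub>n = \<Omega>\<^sub>m\<close> by the choice of \<open>c\<close>,
  otherwise because comparing \<open>\<langle>\<Omega>\<^sub>n|Y\<^sub>m\<rangle>\<close> with \<open>\<langle>\<Omega>\<^sub>n\<^sub>+\<^sub>T|Y\<^sub>m\<^sub>+\<^sub>T\<rangle>\<close> brings in a product that tends to 0.
  Hence \<open>Y\<^sub>0\<close> is orthogonal to the whole space, that is, \<open>P \<Omega>\<^sub>0 = c \<Omega>\<^sub>0\<close>.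
\<close>

theorem irreducible_if_shifts_not_asymptotic:
  assumes unit: "\<And>n. norm (z n) = 1" and \<Omega>: "chain z \<Omega>" and cyc: "unit_cyclic_vector \<pi> (\<Omega> 0)"
    and shifts: "\<And>n m. \<Omega> n = \<Omega> m \<or>
      \<not> summable (\<lambda>t. 1 - cmod (vec_cinner (z (n + int t)) (z (m + int t))))"
  shows "irreducible_rep \<pi>"
  unfolding irreducible_rep_def
proof (intro conjI allI impI)
  have norm_\<Omega>: "norm (\<Omega> n) = 1" for n
    using cyc chain_norm[OF \<Omega> unit, of n 0] by (simp add: unit_cyclic_vector_def)
  show "\<exists>x::'h. x \<noteq> 0" using norm_\<Omega>[of 0] norm_zero zero_neq_one by metis
  fix K
  assume "closed K \<and> 0 \<in> K \<and> (\<forall>x\<in>K. \<forall>y\<in>K. x + y \<in> K) \<and> (\<forall>c. \<forall>x\<in>K. c *\<^sub>C x \<in> K) \<and>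
      (\<forall>a. \<pi> a ` K \<subseteq> K)"
  then have K: "closed K" "0 \<in> K" "\<And>x y. x \<in> K \<Longrightarrow> y \<in> K \<Longrightarrow> x + y \<in> K"
      "\<And>c x. x \<in> K \<Longrightarrow> c *\<^sub>C x \<in> K" and inv: "\<And>a x. x \<in> K \<Longrightarrow> \<pi> a x \<in> K"
    by (blast, blast, blast, blast, blast)
  define P where "P x = (SOME y. y \<in> K \<and> (\<forall>k\<in>K. cinner k (x - y) = 0))" for x
  have P: "P x \<in> K \<and> (\<forall>k\<in>K. cinner k (x - P x) = 0)" for x
  proof -
    have "\<exists>y. y \<in> K \<and> (\<forall>k\<in>K. cinner k (x - y) = 0)"
      using orthogonal_projection_exists[OF K, of x] unfolding Bex_def .
    then show ?thesis unfolding P_def by (rule someI_ex)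
  qed
  have P_unique: "P x = y" if y: "y \<in> K" "\<And>k. k \<in> K \<Longrightarrow> cinner k (x - y) = 0" for x y
  proof -
    have d: "P x - y \<in> K"
      using K(3)[of "P x" "(- 1) *\<^sub>C y"] K(4)[OF y(1), of "- 1"] P[of x]
      by (simp add: scaleC_minus_left)
    have "P x - y = (x - y) - (x - P x)" by simp
    then have "cinner (P x - y) (P x - y) = cinner (P x - y) (x - y) - cinner (P x - y) (x - P x)"
      by (metis cinner_diff_right)
    also have "\<dots> = 0" using d y(2) P[of x] by simp
    finally show ?thesis by (simp add: cinner_eq_zero_iff)
  qed
  have P_commute: "P (\<pi> a x) = \<pi> a (P x)" for a x
  proof (rule P_unique)
    show "\<pi> a (P x) \<in> K" using P inv by blast
    fix k assume "k \<in> K"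
    then have "cinner (\<pi> (star a) k) (x - P x) = 0" using P inv by blast
    then show "cinner k (\<pi> a x - \<pi> a (P x)) = 0" by (simp add: rep_adjoint rep_diff_right)
  qed
  have P\<Omega>: "chain z (\<lambda>n. P (\<Omega> n))"
    using \<Omega> unfolding chain_def by (metis P_commute)
  define c where "c = cinner (\<Omega> 0) (P (\<Omega> 0))"
  define Y where "Y n = P (\<Omega> n) - c *\<^sub>C \<Omega> n" for n
  have Y: "chain z Y"
    unfolding Y_def by (intro chain_diff P\<Omega> chain_scaleC \<Omega>)
  have "cinner (\<Omega> n) (Y m) = 0" for n m
    using shifts[of n m]
  proof
    assume eq: "\<Omega> n = \<Omega> m"
    have "cinner (\<Omega> m) (P (\<Omega> m)) = c"
      unfolding c_def by (rule chain_cinner_same_shift[OF \<Omega> P\<Omega> unit])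
    moreover have "cinner (\<Omega> m) (\<Omega> m) = 1" using norm_\<Omega>[of m] by (simp add: norm_eq_one_iff)
    ultimately show ?thesis by (simp add: eq Y_def cinner_diff_right cinner_scaleC_right)
  next
    define b where "b t = cmod (vec_cinner (z (n + int t)) (z (m + int t)))" for t
    assume "\<not> summable (\<lambda>t. 1 - cmod (vec_cinner (z (n + int t)) (z (m + int t))))"
    then have ns: "\<not> summable (\<lambda>t. 1 - b t)" by (simp add: b_def)
    define M where "M = norm (Y 0) + 1"
    have M: "M > 0" by (simp add: M_def add_nonneg_pos)
    have bound: "cmod (cinner (\<Omega> n) (Y m)) / M \<le> (\<Prod>t<T. b t)" for T
    proof -
      have "cmod (cinner (\<Omega> (n + int T)) (Y (m + int T))) \<le> norm (Y (m + int T))"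
        using Cauchy_Schwarz_cinner[of "\<Omega> (n + int T)" "Y (m + int T)"] by (simp add: norm_\<Omega>)
      also have "\<dots> \<le> M" using chain_norm[OF Y unit, of "m + int T" 0] by (simp add: M_def)
      finally have "(\<Prod>t<T. b t) * cmod (cinner (\<Omega> (n + int T)) (Y (m + int T))) \<le> (\<Prod>t<T. b t) * M"
        by (intro mult_left_mono prod_nonneg) (auto simp: b_def)
      moreover have "cmod (cinner (\<Omega> n) (Y m)) =
          (\<Prod>t<T. b t) * cmod (cinner (\<Omega> (n + int T)) (Y (m + int T)))"
        by (subst chain_cinner[OF \<Omega> Y, of n m T]) (simp add: norm_mult prod_norm[symmetric] b_def)
      ultimately show ?thesis using M by (simp add: field_simps)
    qed
    show ?thesis
    proof (rule ccontr)
      assume "cinner (\<Omega> n) (Y m) \<noteq> 0"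
      then have "cmod (cinner (\<Omega> n) (Y m)) / M > 0" using M by simp
      from summable_one_minus_if_prod_bounded_below[of b, OF _ _ this bound]
      show False using ns cmod_vec_cinner_le_one[OF unit unit] by (simp add: b_def)
    qed
  qed
  then have "cinner (\<Omega> 0) (\<pi> a (Y 0)) = 0" for a
    by (rule chain_orthogonal_imp_disjoint[OF \<Omega> Y])
  then have "Y 0 = 0"
    by (intro cyclic_vector_orthogonal_imp_zero[OF cyc]) (simp add: rep_adjoint')
  then have P0: "P (\<Omega> 0) = c *\<^sub>C \<Omega> 0" by (simp add: Y_def)
  show "K = {0} \<or> K = UNIV"
  proof (cases "c = 0")
    case True
    have "k = 0" if k: "k \<in> K" for k
    proof (rule cyclic_vector_orthogonal_imp_zero[OF cyc])
      fix a
      have "cinner (\<pi> (star a) k) (\<Omega> 0) = 0" using P[of "\<Omega> 0"] inv[OF k] P0 True by simp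
      then show "cinner (\<pi> a (\<Omega> 0)) k = 0"
        by (subst cinner_commute) (simp add: rep_adjoint)
    qed
    then show ?thesis using K(2) by blast
  next
    case False
    have "inverse c *\<^sub>C P (\<Omega> 0) \<in> K" using P K(4) by blast
    then have "\<Omega> 0 \<in> K" using False by (simp add: P0 scaleC_scaleC)
    then have "closure (range (\<lambda>a. \<pi> a (\<Omega> 0))) \<subseteq> K"
      using inv K(1) by (intro closure_minimal) auto
    then show ?thesis using cyc by (auto simp: unit_cyclic_vector_def)
  qed
qed

text \<open>
  The vectors that generate a subspace orthogonal to \<open>F\<^sub>0\<close> form a closed invariant subspace.  It
  contains \<open>G\<^sub>0\<close> but not \<open>F\<^sub>0\<close>.
\<close>

theorem reducible_if_orthogonal_chains:
  assumes F: "chain z F" and G: "chain z G" and orth: "\<And>n m. cinner (F n) (G m) = 0"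
    and nonzero: "F 0 \<noteq> 0" "G 0 \<noteq> 0"
  shows "\<not> irreducible_rep \<pi>"
proof
  assume irr: "irreducible_rep \<pi>"
  define K where "K = {y. \<forall>a. cinner (F 0) (\<pi> a y) = 0}"
  have "closed K"
    unfolding K_def
    by (intro closed_Collect_all closed_Collect_eq continuous_on_const
        bounded_linear.continuous_on[OF bounded_linear_compose[OF bounded_linear_cinner_right
          rep_bounded_linear, unfolded o_def] continuous_on_id])
  moreover have "\<pi> b y \<in> K" if y: "y \<in> K" for b y
    using y unfolding K_def by (simp flip: rep_mult)
  ultimately have "K = {0} \<or> K = UNIV"
    using irr unfolding irreducible_rep_def
    by (elim conjE allE[of _ K] impE)
       (auto simp: K_def rep_zero_right cinner_add_right rep_add_right rep_scaleC_right
         cinner_scaleC_right)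
  moreover have "G 0 \<in> K"
    unfolding K_def using chain_orthogonal_imp_disjoint[OF F G orth] by blast
  moreover have "F 0 \<notin> K"
    using nonzero(1) unfolding K_def by (auto intro!: exI[of _ 1] simp: rep_one cinner_eq_zero_iff)
  ultimately show False using nonzero(2) by blast
qed

end

section \<open>Pure tensors and their factorisations\<close>

lemma tensor_vec_mult_apply:
  "(tensor_vec v \<otimes>\<^sub>t t) w = (case w of [] \<Rightarrow> 0 | i # w' \<Rightarrow> v $ i * t w')"
proof (cases w)
  case (Cons i w')
  have "(\<Sum>k\<le>length w'. tensor_vec v (i # take k w') * t (drop k w')) = v $ i * t w'"
    by (cases w') (simp_all add: tensor_vec_def sum.atMost_Suc_shift del: sum.atMost_Suc)
  then show ?thesis
    by (simp add: tensor_mult_def Cons sum.atMost_Suc_shift tensor_vec_def del: sum.atMost_Suc)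
qed (simp add: tensor_mult_def tensor_vec_def)

lemma pure_tensor_Nil: "pure_tensor [] = tensor_one"
  by (simp add: pure_tensor_def)

lemma pure_tensor_Cons: "pure_tensor (v # zs) = tensor_vec v \<otimes>\<^sub>t pure_tensor zs"
  by (simp add: pure_tensor_def)

lemma pure_tensor_Cons_apply:
  "pure_tensor (v # zs) w = (case w of [] \<Rightarrow> 0 | i # w' \<Rightarrow> v $ i * pure_tensor zs w')"
  by (simp add: pure_tensor_Cons tensor_vec_mult_apply)

lemma pure_tensor_eq_zero_if_length:
  "length w \<noteq> length zs \<Longrightarrow> pure_tensor zs w = 0"
  by (induction zs arbitrary: w)
     (auto simp: pure_tensor_Nil tensor_one_def pure_tensor_Cons_apply split: list.splits)

lemma pure_tensor_nonzero: "0 \<notin> set zs \<Longrightarrow> \<exists>w. pure_tensor zs w \<noteq> 0"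
proof (induction zs)
  case Nil
  then show ?case by (auto simp: pure_tensor_Nil tensor_one_def)
next
  case (Cons v zs)
  then obtain w where "pure_tensor zs w \<noteq> 0" by auto
  moreover obtain i where "v $ i \<noteq> 0" using Cons.prems by (auto simp: vec_eq_iff)
  ultimately show ?case by (intro exI[of _ "i # w"]) (simp add: pure_tensor_Cons_apply)
qed

lemma tensor_one_mult: "tensor_one \<otimes>\<^sub>t t = t"
proof
  fix w
  show "(tensor_one \<otimes>\<^sub>t t) w = t w"
    by (cases w) (simp_all add: tensor_mult_def tensor_one_def sum.atMost_Suc_shift
        del: sum.atMost_Suc)
qed

lemma tensor_vec_mult_assoc: "(tensor_vec v \<otimes>\<^sub>t t) \<otimes>\<^sub>t u = tensor_vec v \<otimes>\<^sub>t (t \<otimes>\<^sub>t u)"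
proof
  fix w
  show "((tensor_vec v \<otimes>\<^sub>t t) \<otimes>\<^sub>t u) w = (tensor_vec v \<otimes>\<^sub>t (t \<otimes>\<^sub>t u)) w"
  proof (cases w)
    case (Cons i w')
    have "((tensor_vec v \<otimes>\<^sub>t t) \<otimes>\<^sub>t u) w
        = (\<Sum>k\<le>length w'. v $ i * (t (take k w') * u (drop k w')))"
      by (subst tensor_mult_def)
         (simp add: Cons tensor_vec_mult_apply sum.atMost_Suc_shift mult.assoc del: sum.atMost_Suc)
    then show ?thesis
      by (simp add: Cons tensor_vec_mult_apply tensor_mult_def[of t u] sum_distrib_left)
  qed (simp add: tensor_mult_def tensor_vec_def)
qed

lemma pure_tensor_append: "pure_tensor (xs @ ys) = pure_tensor xs \<otimes>\<^sub>t pure_tensor ys"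
  by (induction xs)
     (simp_all add: pure_tensor_Nil tensor_one_mult pure_tensor_Cons tensor_vec_mult_assoc)

lemma tensor_power_pure_tensor:
  "tensor_power (pure_tensor ys) p = pure_tensor (concat (replicate p ys))"
  by (induction p) (simp_all add: pure_tensor_Nil pure_tensor_append)

lemma tensor_power_scale:
  "tensor_power (\<lambda>w. c * y w) p = (\<lambda>w. c ^ p * tensor_power y p w)"
proof (induction p)
  case (Suc p)
  have "((\<lambda>w. c * y w) \<otimes>\<^sub>t (\<lambda>w. c ^ p * t w)) w = c ^ Suc p * (y \<otimes>\<^sub>t t) w" for t w
    by (simp add: tensor_mult_def sum_distrib_left mult_ac)
  then show ?case by (simp only: tensor_power.simps Suc)
qed simp

lemma pure_tensor_scale_Cons: "pure_tensor ((c *\<^sub>C v) # vs) = (\<lambda>w. c * pure_tensor (v # vs) w)"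
  by (auto simp: pure_tensor_Cons_apply split: list.splits)

lemma pure_tensor_phases:
  assumes "list_all2 (\<lambda>x y. \<exists>c. cmod c = 1 \<and> x = c *\<^sub>C y) xs ys"
  shows "\<exists>C. cmod C = 1 \<and> pure_tensor xs = (\<lambda>w. C * pure_tensor ys w)"
  using assms
proof (induction rule: list_all2_induct)
  case Nil
  show ?case by (intro exI[of _ 1]) simp
next
  case (Cons x xs y ys)
  then obtain c C where c: "cmod c = 1" "x = c *\<^sub>C y"
    and C: "cmod C = 1" "pure_tensor xs = (\<lambda>w. C * pure_tensor ys w)" by blast
  show ?case
    by (rule exI[of _ "c * C"])
       (use c C in \<open>auto simp: norm_mult pure_tensor_Cons_apply fun_eq_iff split: list.splits\<close>)
qed

text \<open>
  The factorisation of a nonzero pure tensor is unique up to scalars, so it makes sense to speak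
  of the operators \<open>s(z\<^sup>(\<^sup>i\<^sup>)) \<dots> s(z\<^sup>(\<^sup>k\<^sup>))\<close> up to scalars without choosing it.
\<close>

lemma pure_tensor_factorisation_unique:
  fixes s :: "'n::finite \<Rightarrow> 'a::cstar_algebra_1"
  assumes "length xs = length ys" and "0 \<notin> set xs"
    and "pure_tensor xs = (\<lambda>w. C * pure_tensor ys w)"
  shows "s_prod s xs = C *\<^sub>C s_prod s ys \<and>
    (\<forall>i. \<exists>c. c \<noteq> 0 \<and> s_prod s (drop i xs) = c *\<^sub>C s_prod s (drop i ys))"
  using assms
proof (induction xs ys arbitrary: C rule: list_induct2)
  case Nil
  from fun_cong[OF Nil(2), of "[]"] have "C = 1" by (simp add: pure_tensor_Nil tensor_one_def)
  then show ?case by (auto intro!: exI[of _ 1])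
next
  case (Cons x xs y ys)
  obtain w0 where w0: "pure_tensor xs w0 \<noteq> 0" using pure_tensor_nonzero[of xs] Cons.prems by auto
  obtain i where i: "x $ i \<noteq> 0" using Cons.prems by (auto simp: vec_eq_iff)
  have eq: "x $ j * pure_tensor xs w = C * (y $ j * pure_tensor ys w)" for j w
    using fun_cong[OF Cons.prems(2), of "j # w"] by (simp add: pure_tensor_Cons_apply)
  have C0: "C \<noteq> 0" using eq[of i w0] i w0 by auto
  define c where "c = C * pure_tensor ys w0 / pure_tensor xs w0"
  have nth: "x $ j = c * y $ j" for j using eq[of j w0] w0 by (simp add: c_def field_simps)
  then have x: "x = c *\<^sub>C y" by (simp add: vec_eq_iff)
  have c0: "c \<noteq> 0" and yi: "y $ i \<noteq> 0" using nth[of i] i by auto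
  have "pure_tensor xs = (\<lambda>w. (C / c) * pure_tensor ys w)"
  proof
    fix w
    show "pure_tensor xs w = (C / c) * pure_tensor ys w"
      using eq[of i w] nth[of i] c0 yi by (simp add: field_simps)
  qed
  from Cons.IH[OF _ this] Cons.prems(1) have IH: "s_prod s xs = (C / c) *\<^sub>C s_prod s ys"
    "\<And>i. \<exists>c. c \<noteq> 0 \<and> s_prod s (drop i xs) = c *\<^sub>C s_prod s (drop i ys)" by auto
  have xy: "s_vec s x = c *\<^sub>C s_vec s y"
    by (simp add: x s_vec_def scaleC_sum_right scaleC_scaleC)
  have "s_prod s (x # xs) = s_vec s x * s_prod s xs" by (simp add: s_prod_def)
  also have "\<dots> = C *\<^sub>C (s_vec s y * s_prod s ys)"
    unfolding IH(1) xy using c0 by (simp add: scaleC_mult_left scaleC_mult_right scaleC_scaleC)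
  finally have top: "s_prod s (x # xs) = C *\<^sub>C s_prod s (y # ys)" by (simp add: s_prod_def)
  have "\<exists>c. c \<noteq> 0 \<and> s_prod s (drop i (x # xs)) = c *\<^sub>C s_prod s (drop i (y # ys))" for i
    using top C0 IH(2) by (cases i) auto
  then show ?case using top by blast
qed

lemma length_concat_replicate: "length (concat (replicate p ys)) = p * length ys"
  by (induction p) simp_all

lemma nth_concat_replicate:
  "i < p * length ys \<Longrightarrow> concat (replicate p ys) ! i = ys ! (i mod length ys)"
proof (induction p arbitrary: i)
  case (Suc p)
  show ?case
  proof (cases "i < length ys")
    case False
    then show ?thesis using Suc by (simp add: nth_append le_mod_geq)
  qed (simp add: nth_append)
qed simp

section \<open>Cycles\<close>

definition phase_equivalent :: "'b::chilbert_space \<Rightarrow> 'b \<Rightarrow> bool" where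
  "phase_equivalent u v \<longleftrightarrow> (\<exists>c. cmod c = 1 \<and> u = c *\<^sub>C v)"

lemma phase_equivalent_refl: "phase_equivalent u u"
  by (auto simp: phase_equivalent_def intro: exI[of _ 1])

lemma phase_equivalent_sym: "phase_equivalent u v \<Longrightarrow> phase_equivalent v u"
  unfolding phase_equivalent_def
proof (elim exE conjE)
  fix c assume "cmod c = 1" "u = c *\<^sub>C v"
  then show "\<exists>c. cmod c = 1 \<and> v = c *\<^sub>C u"
    by (intro exI[of _ "inverse c"], cases "c = 0") (simp_all add: scaleC_scaleC norm_inverse)
qed

lemma phase_equivalent_trans:
  "phase_equivalent u v \<Longrightarrow> phase_equivalent v w \<Longrightarrow> phase_equivalent u w"
  unfolding phase_equivalent_def
proof (elim exE conjE)
  fix c d assume "cmod c = 1" "u = c *\<^sub>C v" "cmod d = 1" "v = d *\<^sub>C w"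
  then show "\<exists>c. cmod c = 1 \<and> u = c *\<^sub>C w"
    by (intro exI[of _ "c * d"]) (simp add: scaleC_scaleC norm_mult)
qed

lemma phase_equivalent_shift_multiple:
  assumes "\<And>i::int. phase_equivalent (f i) (f (i + q))"
  shows "phase_equivalent (f i) (f (i + a * q))"
proof -
  have up: "phase_equivalent (f i) (f (i + int t * q))" for i t
  proof (induction t)
    case (Suc t)
    have "f (i + int (Suc t) * q) = f (i + int t * q + q)" by (simp add: algebra_simps)
    then show ?case using phase_equivalent_trans[OF Suc assms[of "i + int t * q"]] by simp
  qed (simp add: phase_equivalent_refl)
  show ?thesis
  proof (cases "a \<ge> 0")
    case True
    then show ?thesis using up[of i "nat a"] by simp
  next
    case False
    then show ?thesis
      using phase_equivalent_sym[OF up[of "i + a * q" "nat (- a)"]] by simp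
  qed
qed

text \<open>
  If shifting a \<open>k\<close>-periodic sequence by \<open>q\<close> changes only phases, then by Bezout's identity so does
  shifting it by \<open>gcd q k\<close>.  The tensor is therefore, up to a phase, a power of the product of its
  first \<open>gcd q k\<close> factors.
\<close>

lemma periodic_if_shift_phase_equivalent:
  fixes zs :: "(complex ^ 'n::finite) list"
  assumes zs: "zs \<noteq> []" "set zs \<subseteq> sphere 0 1" and k: "k = int (length zs)" and q: "\<not> k dvd q"
    and f: "f = (\<lambda>n. zs ! nat (n mod k))"
    and shift: "\<And>i. phase_equivalent (f i) (f (i + q))"
  shows "periodic (pure_tensor zs)"
proof -
  have k0: "k > 0" using zs(1) k by simp
  define d where "d = gcd q k"
  have d0: "d > 0" and dk: "d dvd k" "d dvd q" using k0 by (auto simp: d_def)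
  have "d \<noteq> k" using q dk(2) by auto
  then have dlt: "d < k" using dk(1) k0 zdvd_imp_le by fastforce
  obtain a b where ab: "a * q + b * k = d"
    using bezout_int[of q k] unfolding d_def by blast
  have step: "phase_equivalent (f i) (f (i + d))" for i
  proof -
    have "f (i + d) = f (i + a * q)"
      unfolding f ab[symmetric] by (simp flip: add.assoc)
    then show ?thesis using phase_equivalent_shift_multiple[of f q i a] shift by simp
  qed
  define l where "l = nat d"
  define p where "p = length zs div l"
  have l0: "l \<ge> 1" and dl: "d = int l" using d0 by (auto simp: l_def)
  have lk: "l dvd length zs" "l < length zs"
    using dk(1) dlt by (auto simp: k dl)
  have pl: "p * l = length zs" using lk(1) by (simp add: p_def)
  have p2: "p \<ge> 2"
  proof (rule ccontr)
    assume "\<not> p \<ge> 2"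
    then have "p = 0 \<or> p = 1" by auto
    then show False using pl lk(2) by auto
  qed
  define ys where "ys = take l zs"
  have ys: "length ys = l" using lk by (simp add: ys_def)
  have nth: "phase_equivalent (zs ! i) (ys ! (i mod l))" if i: "i < length zs" for i
  proof -
    have m: "i mod l < l" using l0 by simp
    then have "ys ! (i mod l) = zs ! (i mod l)" by (simp add: ys_def)
    also have "\<dots> = f (int (i mod l))"
      using m lk by (simp add: f k flip: zmod_int)
    finally have y: "ys ! (i mod l) = f (int (i mod l))" .
    have x: "zs ! i = f (int i)" using i by (simp add: f k flip: zmod_int)
    have "int i = int (i mod l) + int (i div l) * d"
      unfolding dl by (simp flip: of_nat_mult of_nat_add)
    then show ?thesis
      using phase_equivalent_sym[OF phase_equivalent_shift_multiple[of f d "int (i mod l)" "int (i div l)"]]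
        step x y by simp
  qed
  have "list_all2 (\<lambda>x y. \<exists>c. cmod c = 1 \<and> x = c *\<^sub>C y) zs (concat (replicate p ys))"
    unfolding list_all2_conv_all_nth
    using nth by (simp add: length_concat_replicate nth_concat_replicate ys pl phase_equivalent_def)
  from pure_tensor_phases[OF this] obtain C where C: "cmod C = 1"
    "pure_tensor zs = (\<lambda>w. C * tensor_power (pure_tensor ys) p w)"
    unfolding tensor_power_pure_tensor by blast
  define D where "D = cis (Arg C / p)"
  have "C \<noteq> 0" using C(1) by auto
  then have "cis (Arg C) = C" using C(1) by (simp add: cis_Arg sgn_eq)
  moreover have "D ^ p = cis (real p * (Arg C / real p))" unfolding D_def by (rule Complex.DeMoivre)
  ultimately have D: "cmod D = 1" "D ^ p = C" using p2 by (simp_all add: D_def)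
  \<comment> \<open>The remaining phase is absorbed into the first factor of the root.\<close>
  obtain y ys' where y: "ys = y # ys'" using ys l0 by (cases ys) auto
  define us where "us = (D *\<^sub>C y) # ys'"
  have "tensor_power (pure_tensor us) p = pure_tensor zs"
    unfolding us_def pure_tensor_scale_Cons tensor_power_scale C D y[symmetric] ..
  moreover have "set us \<subseteq> sphere 0 1"
  proof -
    have "set ys \<subseteq> sphere 0 1" using zs(2) set_take_subset[of l zs] by (auto simp: ys_def)
    then show ?thesis using D by (auto simp: us_def y norm_scaleC_chilbert)
  qed
  moreover have "length us = l" using ys by (simp add: us_def y)
  ultimately show ?thesis
    unfolding periodic_def sphere_tensors_deg_def using l0 p2
    by (intro exI[of _ l] conjI bexI[of _ "pure_tensor us"] exI[of _ p]) auto
qed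

context cuntz_representation
begin

lemma s_prod_Cons: "s_prod s (v # vs) = s_vec s v * s_prod s vs"
  by (simp add: s_prod_def)

lemma s_prod_Nil: "s_prod s [] = 1"
  by (simp add: s_prod_def)

lemma cycle_chain:
  fixes zs :: "(complex ^ 'n) list"
  assumes zs: "zs \<noteq> []" and fixed: "\<pi> (s_prod s zs) \<Omega> = \<Omega>"
  shows "chain (\<lambda>n. zs ! nat (n mod int (length zs)))
    (\<lambda>n. \<pi> (s_prod s (drop (nat (n mod int (length zs))) zs)) \<Omega>)"
  unfolding chain_def
proof
  fix n
  define k where "k = int (length zs)"
  define i where "i = nat (n mod k)"
  have k0: "k > 0" using zs by (simp add: k_def)
  have i: "i < length zs" "int i = n mod k" using k0 by (auto simp: i_def k_def nat_less_iff)
  have "(n + 1) mod k = (int i + 1) mod k" by (simp add: i(2) mod_simps)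
  then have succ: "nat ((n + 1) mod k) = (if Suc i < length zs then Suc i else 0)"
    using i(1) by (cases "Suc i = length zs") (auto simp: k_def add.commute simp flip: of_nat_Suc)
  have "\<pi> (s_prod s (drop i zs)) \<Omega> = S (zs ! i) (\<pi> (s_prod s (drop (Suc i) zs)) \<Omega>)"
    by (simp add: s_prod_Cons rep_mult flip: Cons_nth_drop_Suc[OF i(1)])
  moreover have "\<pi> (s_prod s (drop (Suc i) zs)) \<Omega> = \<pi> (s_prod s (drop (nat ((n + 1) mod k)) zs)) \<Omega>"
    using i(1) unfolding succ by (simp add: fixed s_prod_Nil rep_one)
  ultimately show "\<pi> (s_prod s (drop (nat (n mod int (length zs))) zs)) \<Omega> =
      S (zs ! nat (n mod int (length zs)))
        (\<pi> (s_prod s (drop (nat ((n + 1) mod int (length zs))) zs)) \<Omega>)"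
    by (simp add: i_def k_def)
qed

text \<open>
  A summable periodic sequence is zero, so summability of the defects \<open>1 - \<bar>\<langle>z\<^sub>n\<^sub>+\<^sub>t|z\<^sub>m\<^sub>+\<^sub>t\<rangle>\<bar>\<close>
  forces equality in the Cauchy-Schwarz inequality at every index.
\<close>

lemma nonperiodic_cycle_irreducible:
  assumes GP: "GP_cycle s \<pi> z" and nonper: "\<not> periodic z"
  shows "irreducible_rep \<pi>"
proof -
  obtain zs \<Omega> where zs: "zs \<noteq> []" "set zs \<subseteq> sphere 0 1" "z = pure_tensor zs"
    and cyc: "unit_cyclic_vector \<pi> \<Omega>" and fixed: "\<pi> (s_prod s zs) \<Omega> = \<Omega>"
    using GP unfolding GP_cycle_def by blast
  define k where "k = int (length zs)"
  define f where "f n = zs ! nat (n mod k)" for n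
  have k0: "k > 0" using zs(1) by (simp add: k_def)
  have "nat (n mod k) < length zs" for n using k0 by (simp add: nat_less_iff k_def)
  then have unit: "norm (f n) = 1" for n
    using zs(2) nth_mem unfolding f_def by (metis (no_types) dist_0_norm mem_sphere subsetD)
  have f_mod: "f n = f m" if "n mod k = m mod k" for n m
    using that by (simp add: f_def)
  show ?thesis
  proof (rule irreducible_if_shifts_not_asymptotic)
    show "chain f (\<lambda>n. \<pi> (s_prod s (drop (nat (n mod k)) zs)) \<Omega>)"
      unfolding f_def k_def by (rule cycle_chain[OF zs(1) fixed])
    show "unit_cyclic_vector \<pi> (\<pi> (s_prod s (drop (nat (0 mod k)) zs)) \<Omega>)"
      using cyc by (simp add: fixed)
    fix n m
    show "\<pi> (s_prod s (drop (nat (n mod k)) zs)) \<Omega> = \<pi> (s_prod s (drop (nat (m mod k)) zs)) \<Omega> \<or>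
        \<not> summable (\<lambda>t. 1 - cmod (vec_cinner (f (n + int t)) (f (m + int t))))"
    proof (rule disjCI, rule ccontr)
      assume "\<not> \<not> summable (\<lambda>t. 1 - cmod (vec_cinner (f (n + int t)) (f (m + int t))))"
      then have sm: "summable (\<lambda>t. 1 - cmod (vec_cinner (f (n + int t)) (f (m + int t))))" by blast
      assume "\<pi> (s_prod s (drop (nat (n mod k)) zs)) \<Omega> \<noteq> \<pi> (s_prod s (drop (nat (m mod k)) zs)) \<Omega>"
      then have q: "\<not> k dvd m - n" using mod_eq_dvd_iff[of m k n] by auto
      have one: "cmod (vec_cinner (f (n + int t)) (f (m + int t))) = 1" for t
      proof -
        define r where "r = 1 - cmod (vec_cinner (f (n + int t)) (f (m + int t)))"
        have "strict_mono (\<lambda>j. t + j * length zs)" using zs(1) by (simp add: strict_mono_def)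
        from LIMSEQ_subseq_LIMSEQ[OF summable_LIMSEQ_zero[OF sm] this]
        have "(\<lambda>j. 1 - cmod (vec_cinner (f (n + int (t + j * length zs)))
            (f (m + int (t + j * length zs))))) \<longlonglongrightarrow> 0"
          by (simp add: o_def)
        moreover have "f (i + int (t + j * length zs)) = f (i + int t)" for i j
          by (rule f_mod) (simp add: k_def flip: add.assoc)
        ultimately have "(\<lambda>j::nat. r) \<longlonglongrightarrow> 0" by (simp add: r_def)
        then have "r = 0" using LIMSEQ_const_iff by blast
        then show ?thesis by (simp add: r_def)
      qed
      have "phase_equivalent (f i) (f (i + (m - n)))" for i
      proof -
        define t where "t = nat ((i - n) mod k)"
        have t: "int t = (i - n) mod k" using k0 by (simp add: t_def)
        have "f (n + int t) = f i" "f (m + int t) = f (i + (m - n))"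
          by (rule f_mod, simp add: t mod_simps algebra_simps)+
        then have "cmod (vec_cinner (f i) (f (i + (m - n)))) = 1" using one[of t] by simp
        then have "cmod (cinner (f (i + (m - n))) (f i)) = 1"
          unfolding vec_cinner_eq_cinner by (subst cinner_commute) simp
        then show ?thesis
          unfolding phase_equivalent_def
          using cinner_unit_eq_imp_proportional[OF unit unit] by blast
      qed
      then have "periodic z"
        unfolding zs(3)
        by (intro periodic_if_shift_phase_equivalent[OF zs(1,2) k_def q]) (auto simp: f_def)
      then show False using nonper by blast
    qed
  qed (rule unit)
qed

text \<open>
  For \<open>z = y\<^sup>\<otimes>\<^sup>p\<close> the operator \<open>s(y)\<close> permutes the cycle \<open>V\<^sub>0, V\<^sub>l, \<dots>\<close> of length \<open>p\<close>.  Its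
  eigenvectors for different eigenvalues generate orthogonal subspaces.
\<close>

lemma periodic_cycle_reducible:
  assumes GP: "GP_cycle s \<pi> z" and per: "periodic z"
  shows "\<not> irreducible_rep \<pi>"
proof -
  obtain zs \<Omega> where zs: "zs \<noteq> []" "set zs \<subseteq> sphere 0 1" "z = pure_tensor zs"
    and cyc: "unit_cyclic_vector \<pi> \<Omega>" and fixed: "\<pi> (s_prod s zs) \<Omega> = \<Omega>"
    and orth: "orthonormal_family {..<length zs} (\<lambda>i. \<pi> (s_prod s (drop i zs)) \<Omega>)"
    using GP unfolding GP_cycle_def by blast
  obtain ys p where ys: "length ys \<ge> 1" "set ys \<subseteq> sphere 0 1" and p: "p \<ge> 2"
    and z_power: "z = tensor_power (pure_tensor ys) p"
    using per unfolding periodic_def sphere_tensors_deg_def by auto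
  define us where "us = concat (replicate p ys)"
  have eq: "pure_tensor zs = (\<lambda>w. 1 * pure_tensor us w)"
    using zs(3) z_power by (simp add: us_def tensor_power_pure_tensor)
  have zs0: "0 \<notin> set zs" using zs(2) by auto
  have len: "length zs = length us"
  proof -
    obtain w where "pure_tensor zs w \<noteq> 0" using pure_tensor_nonzero[OF zs0] by blast
    then show ?thesis using eq pure_tensor_eq_zero_if_length by (metis mult_1)
  qed
  note factor = pure_tensor_factorisation_unique[OF len zs0 eq, of s]
  define l where "l = int (length ys)"
  define k where "k = int (length us)"
  have l0: "l > 0" using ys(1) unfolding l_def by linarith
  have k: "k = int p * l" by (simp add: k_def l_def us_def length_concat_replicate)
  have k0: "k > 0" using p l0 by (simp add: k)
  have us: "us \<noteq> []" using k0 by (auto simp: k_def)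
  define f where "f n = us ! nat (n mod k)" for n
  define V where "V n = \<pi> (s_prod s (drop (nat (n mod k)) us)) \<Omega>" for n
  have "\<pi> (s_prod s us) \<Omega> = \<Omega>" using factor fixed by simp
  then have V: "chain f V" and V0: "V 0 = \<Omega>"
    unfolding f_def V_def k_def using cycle_chain[OF us] by auto
  have f_ys: "f n = ys ! nat (n mod l)" for n
  proof -
    have "nat (n mod k) < p * length ys"
      using k0 k by (simp add: nat_less_iff l_def)
    moreover have "nat (n mod k) mod length ys = nat (n mod l)"
    proof -
      have "int (nat (n mod k) mod length ys) = (n mod k) mod l"
        using k0 by (simp add: zmod_int l_def)
      also have "\<dots> = n mod l" by (simp add: k mod_mod_cancel)
      finally show ?thesis by simp
    qed
    ultimately show ?thesis by (simp add: f_def us_def nth_concat_replicate)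
  qed
  have unit: "norm (f n) = 1" for n
  proof -
    have "nat (n mod l) < length ys" using l0 by (simp add: nat_less_iff l_def)
    then have "f n \<in> sphere 0 1" unfolding f_ys using ys(2) nth_mem by blast
    then show ?thesis by simp
  qed
  have f_l: "f (n + l * int i) = f n" for n i by (simp add: f_ys)
  have V_mod: "V n = V m" if "n mod k = m mod k" for n m using that by (simp add: V_def)
  have V_orth: "cinner (V n) (V m) = 0" if "n mod k \<noteq> m mod k" for n m
  proof -
    have lt: "nat (i mod k) < length zs" for i using k0 by (simp add: nat_less_iff k_def len)
    obtain c d where cd: "c \<noteq> 0" "s_prod s (drop (nat (n mod k)) zs) = c *\<^sub>C s_prod s (drop (nat (n mod k)) us)"
      "d \<noteq> 0" "s_prod s (drop (nat (m mod k)) zs) = d *\<^sub>C s_prod s (drop (nat (m mod k)) us)"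
      using factor by blast
    have "nat (n mod k) \<noteq> nat (m mod k)" using that k0 by (simp add: nat_eq_iff)
    then have "cinner (\<pi> (s_prod s (drop (nat (n mod k)) zs)) \<Omega>)
        (\<pi> (s_prod s (drop (nat (m mod k)) zs)) \<Omega>) = 0"
      using orth lt[of n] lt[of m] unfolding orthonormal_family_def by simp
    then show ?thesis
      using cd(1,3) unfolding V_def cd(2,4)
      by (simp add: rep_scaleC_left cinner_scaleC_left cinner_scaleC_right)
  qed
  define G where "G \<omega> n = (\<Sum>i<p. \<omega> ^ i *\<^sub>C V (n + l * int i))" for \<omega> :: complex and n
  have G: "chain f (G \<omega>)" for \<omega>
    unfolding G_def
  proof (intro chain_sum chain_scaleC)
    fix i
    show "chain f (\<lambda>n. V (n + l * int i))"
      unfolding chain_def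
    proof
      fix n
      have "V (n + l * int i) = S (f (n + l * int i)) (V (n + l * int i + 1))"
        using V unfolding chain_def by blast
      then show "V (n + l * int i) = S (f n) (V (n + 1 + l * int i))"
        by (simp add: f_l ac_simps)
    qed
  qed
  have G_shift: "\<omega> *\<^sub>C G \<omega> (n + l) = G \<omega> n" if "\<omega> ^ p = 1" for \<omega> n
  proof -
    define g where "g i = \<omega> ^ i *\<^sub>C V (n + l * int i)" for i
    have gp: "g p = g 0"
      using that V_mod[of "n + l * int p" n] by (simp add: g_def k mult.commute)
    have "\<omega> *\<^sub>C G \<omega> (n + l) = (\<Sum>i<p. g (Suc i))"
      by (simp add: G_def g_def scaleC_sum_right scaleC_scaleC algebra_simps)
    also have "\<dots> = (\<Sum>i<p. g i)"
      using sum.lessThan_Suc_shift[of g p] gp by simp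
    finally show ?thesis by (simp add: G_def g_def)
  qed
  have G_nonzero: "G \<omega> 0 \<noteq> 0" for \<omega>
  proof
    assume "G \<omega> 0 = 0"
    have "cinner (V 0) (V (l * int i)) = 0" if "i < p" "i \<noteq> 0" for i
    proof (rule V_orth)
      have "(l * int i) mod k = l * int i"
        using that l0 by (intro mod_pos_pos_trivial) (auto simp: k mult.commute)
      then show "0 mod k \<noteq> (l * int i) mod k" using that l0 by simp
    qed
    then have "cinner (V 0) (G \<omega> 0) = (\<Sum>i<p. if i = 0 then cinner (V 0) (V 0) else 0)"
      unfolding G_def cinner_sum_right by (intro sum.cong) (auto simp: cinner_scaleC_right)
    also have "\<dots> = 1"
      using p cyc by (simp add: V0 unit_cyclic_vector_def norm_eq_one_iff)
    finally show False using \<open>G \<omega> 0 = 0\<close> by simp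
  qed
  obtain \<omega> :: complex where \<omega>: "\<omega> ^ p = 1" "\<omega> \<noteq> 1"
  proof -
    have "card {z::complex. z ^ p = 1} = p" using p by (intro card_roots_unity_eq) auto
    then have "{z::complex. z ^ p = 1} \<noteq> {1}" using p by auto
    then show ?thesis using that power_one by fastforce
  qed
  show ?thesis
  proof (rule reducible_if_orthogonal_chains[OF G G _ G_nonzero G_nonzero])
    fix n m
    show "cinner (G 1 n) (G \<omega> m) = 0"
    proof (cases "l dvd n - m")
      case False
      have "cinner (V (n + l * int i)) (V (m + l * int j)) = 0" for i j
      proof (rule V_orth, rule notI)
        assume "(n + l * int i) mod k = (m + l * int j) mod k"
        then have "k dvd (n + l * int i) - (m + l * int j)" by (simp add: mod_eq_dvd_iff)
        then have "l dvd (n + l * int i) - (m + l * int j)" by (metis dvd_mult_right k)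
        moreover have "(n + l * int i) - (m + l * int j) = (n - m) + l * (int i - int j)"
          by (simp add: algebra_simps)
        ultimately have "l dvd n - m" by (metis dvd_add_left_iff dvd_triv_left)
        then show False using False by blast
      qed
      then show ?thesis
        by (simp add: G_def cinner_sum_left cinner_sum_right cinner_scaleC_left cinner_scaleC_right)
    next
      case True
      then obtain j where j: "n = m + l * j" by (metis diff_add_cancel dvdE add.commute)
      have "G 1 (m + l * i) = G 1 (m + l * (i + 1))" for i
        using G_shift[of 1 "m + l * i"] by (simp add: algebra_simps)
      from int_shift_invariant_imp_constant[of "\<lambda>i. G 1 (m + l * i)", OF this, of j 0]
      have nm: "G 1 n = G 1 m" by (simp add: j)
      have "cinner (G 1 m) (G \<omega> m) = cinner (G 1 (m + l)) (G \<omega> (m + l))"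
        by (rule chain_cinner_same_shift[OF G G unit])
      also have "\<dots> = cinner (G 1 m) (G \<omega> (m + l))" using G_shift[of 1 m] by simp
      finally have "\<omega> * cinner (G 1 m) (G \<omega> (m + l)) = cinner (G 1 m) (G \<omega> (m + l))"
        by (simp add: G_shift[OF \<omega>(1)] flip: cinner_scaleC_right)
      then have "cinner (G 1 m) (G \<omega> (m + l)) = 0" using \<omega>(2) by simp
      then show ?thesis
        using G_shift[OF \<omega>(1), of m] nm by (metis cinner_scaleC_right mult_zero_right)
    qed
  qed
qed

end

section \<open>Square waves in a bilateral shift\<close>

lemma summable_orthogonal_series:
  fixes v :: "nat \<Rightarrow> 'a::chilbert_space"
  assumes orth: "\<And>i j. i \<noteq> j \<Longrightarrow> cinner (v i) (v j) = 0" and sq: "summable (\<lambda>i. (norm (v i))\<^sup>2)"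
  shows "summable v"
proof -
  have pyth: "(norm (sum v A))\<^sup>2 = (\<Sum>i\<in>A. (norm (v i))\<^sup>2)" if "finite A" for A
    using that
  proof induction
    case (insert i A)
    have "cinner (v i) (sum v A) = 0"
      unfolding cinner_sum_right by (intro sum.neutral ballI orth) (use insert.hyps in auto)
    then have "(norm (v i + sum v A))\<^sup>2 = (norm (v i))\<^sup>2 + (norm (sum v A))\<^sup>2"
      by (simp only: norm_add_square) simp
    then show ?case by (simp only: sum.insert[OF insert.hyps] insert.IH)
  qed simp
  show ?thesis
    unfolding summable_Cauchy
  proof (intro allI impI)
    fix e :: real assume e: "0 < e"
    then obtain N where N: "\<And>m n. m \<ge> N \<Longrightarrow> norm (\<Sum>i=m..<n. (norm (v i))\<^sup>2) < e\<^sup>2"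
      using sq unfolding summable_Cauchy by (metis zero_less_power)
    have "norm (sum v {m..<n}) < e" if "m \<ge> N" for m n
    proof -
      have "(norm (sum v {m..<n}))\<^sup>2 < e\<^sup>2"
        using N[OF that, of n] by (simp add: pyth sum_nonneg)
      then show ?thesis using e by (simp add: power2_less_imp_less)
    qed
    then show "\<exists>N. \<forall>m\<ge>N. \<forall>n. norm (sum v {m..<n}) < e" by blast
  qed
qed

definition odd_recip :: "int \<Rightarrow> real" where
  "odd_recip r = (if odd r then 1 / real_of_int r else 0)"

lemma odd_recip_minus: "odd_recip (- r) = - odd_recip r"
  by (simp add: odd_recip_def)

text \<open>
  Raising \<open>e\<close> by one adds two telescoping series, whose sums \<open>-1/(2e+1)\<close> and \<open>1/(2e+1)\<close> cancel.
\<close>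

lemma odd_reciprocal_differences_sum:
  "(\<lambda>k. odd_recip (2 * (int k - int e) + 1) - odd_recip (2 * (int k + int e) + 1)) sums 0"
proof (induction e)
  case (Suc e)
  have lim: "(\<lambda>k. odd_recip (2 * (int k + c) + 1)) \<longlonglongrightarrow> 0" for c
  proof -
    have "(\<lambda>k. 1 / real_of_int (2 * (int k + c) + 1)) \<longlonglongrightarrow> 0"
      by real_asymp
    then show ?thesis by (simp add: odd_recip_def)
  qed
  have "(\<lambda>k. odd_recip (2 * (int k + c) + 1) - odd_recip (2 * (int (Suc k) + c) + 1))
      sums (odd_recip (2 * (int 0 + c) + 1) - 0)" for c
    by (rule telescope_sums'[OF lim])
  from sums_add[OF sums_add[OF Suc this[of "- int e - 1"]] this[of "int e"]]
  have "(\<lambda>k. odd_recip (2 * (int k - int (Suc e)) + 1) - odd_recip (2 * (int k + int (Suc e)) + 1))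
      sums (odd_recip (2 * (- int e - 1) + 1) + odd_recip (2 * int e + 1))"
    by (simp add: algebra_simps)
  moreover have "odd_recip (2 * (- int e - 1) + 1) = - odd_recip (2 * int e + 1)"
    unfolding odd_recip_minus[symmetric] by (simp add: algebra_simps)
  ultimately show ?case by simp
qed simp

text \<open>
  This is \<open>\<Sum> 1/r\<^sup>2\<close> over all odd integers \<open>r\<close>, of either sign.
\<close>

definition odd_square_sum :: real where
  "odd_square_sum = (\<Sum>k. 2 / (2 * real k + 1)\<^sup>2)"

lemma summable_odd_squares: "summable (\<lambda>k. 2 / (2 * real k + 1)\<^sup>2)"
proof (rule summable_comparison_test')
  have "summable (\<lambda>k. inverse (real (Suc k) ^ 2))"
    using inverse_power_summable[of 2, where 'a = real] by (subst summable_Suc_iff) simp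
  then show "summable (\<lambda>k. 2 * inverse (real (Suc k) ^ 2))" by (rule summable_mult)
  fix k
  have "(real (Suc k))\<^sup>2 \<le> (2 * real k + 1)\<^sup>2" by (rule power_mono) auto
  then show "norm (2 / (2 * real k + 1)\<^sup>2) \<le> 2 * inverse (real (Suc k) ^ 2)"
    by (simp add: divide_inverse le_imp_inverse_le)
qed

lemma odd_square_sum_pos: "odd_square_sum > 0"
  unfolding odd_square_sum_def by (rule suminf_pos[OF summable_odd_squares]) simp

text \<open>
  With \<open>r = \<plusminus>(2k+1)\<close> the sum is \<open>\<Sum> 1/(r (r+d))\<close> over odd \<open>r\<close>, for even \<open>d\<close>.  These are, up to sign
  and normalisation, the Fourier coefficients of the square of a square wave, which is constant.
\<close>

lemma odd_recip_convolution:
  "(\<lambda>k. (1 / (2 * real k + 1)) * (odd_recip (2 * int k + 1 + d) - odd_recip (- (2 * int k + 1) + d)))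
    sums (if d = 0 then odd_square_sum else 0)"
proof (cases "even d")
  case False
  then show ?thesis by (auto simp: odd_recip_def)
next
  case True
  show ?thesis
  proof (cases "d = 0")
    case True
    have "(1 / (2 * real k + 1)) * (odd_recip (2 * int k + 1 + d) - odd_recip (- (2 * int k + 1) + d))
        = 2 / (2 * real k + 1)\<^sup>2" for k
      using True odd_recip_minus[of "2 * int k + 1"]
      by (simp add: odd_recip_def power2_eq_square)
    then show ?thesis
      using summable_sums[OF summable_odd_squares] True by (simp add: odd_square_sum_def)
  next
    case False
    define e where "e = nat \<bar>d div 2\<bar>"
    \<comment> \<open>Both sides of the partial fraction identity are even in \<open>d\<close>.\<close>
    have summand: "(1 / (2 * real k + 1)) *
          (odd_recip (2 * int k + 1 + d) - odd_recip (- (2 * int k + 1) + d))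
        = (1 / (2 * real e)) *
          (odd_recip (2 * (int k - int e) + 1) - odd_recip (2 * (int k + int e) + 1))" for k
    proof -
      have pf: "(1 / x) * (1 / (x + y) - 1 / (- x + y)) = (1 / y) * (1 / (x - y) - 1 / (x + y))"
        if "x \<noteq> 0" "y \<noteq> 0" "x + y \<noteq> 0" "x - y \<noteq> 0" for x y :: real
      proof -
        have "- x + y \<noteq> 0" using that by simp
        then show ?thesis using that by (simp add: divide_simps)
      qed
      have odd: "odd (2 * int k + 1 + d)" "odd (- (2 * int k + 1) + d)" using \<open>even d\<close> by auto
      then have nz: "2 * int k + 1 + d \<noteq> 0" "2 * int k + 1 - d \<noteq> 0" by (presburger, presburger)
      have nz': "2 * real k + 1 + real_of_int d \<noteq> 0" "2 * real k + 1 - real_of_int d \<noteq> 0"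
        using nz by (metis (mono_tags) of_int_0_eq_iff of_int_1 of_int_add of_int_diff of_int_mult
            of_int_numeral of_int_of_nat_eq)+
      have lhs: "(1 / (2 * real k + 1)) *
            (odd_recip (2 * int k + 1 + d) - odd_recip (- (2 * int k + 1) + d))
          = (1 / real_of_int d) * (1 / (2 * real k + 1 - real_of_int d) - 1 / (2 * real k + 1 + real_of_int d))"
        using pf[of "2 * real k + 1" "real_of_int d"] odd nz' False by (simp add: odd_recip_def)
      have sign: "(1 / - y) * (1 / (x - - y) - 1 / (x + - y)) = (1 / y) * (1 / (x - y) - 1 / (x + y))"
        for x y :: real
        by (simp only: diff_minus_eq_add add_uminus_conv_diff divide_minus_right mult_minus_left
            mult_minus_right[symmetric] minus_diff_eq)
      have "d = 2 * int e \<or> d = - (2 * int e)" using \<open>even d\<close> by (auto simp: e_def)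
      then have "real_of_int d = 2 * real e \<or> real_of_int d = - (2 * real e)" by auto
      then have "(1 / real_of_int d) * (1 / (2 * real k + 1 - real_of_int d) - 1 / (2 * real k + 1 + real_of_int d))
          = (1 / (2 * real e)) * (1 / (2 * real k + 1 - 2 * real e) - 1 / (2 * real k + 1 + 2 * real e))"
        using sign by (elim disjE) (simp_all only:)
      also have "\<dots> = (1 / (2 * real e)) *
          (odd_recip (2 * (int k - int e) + 1) - odd_recip (2 * (int k + int e) + 1))"
        by (simp add: odd_recip_def algebra_simps)
      finally show ?thesis using lhs by simp
    qed
    show ?thesis
      using sums_mult[OF odd_reciprocal_differences_sum[of e], of "1 / (2 * real e)"] False
      unfolding summand by simp
  qed
qed

text \<open>
  The series of these terms is \<open>\<Sum> x\<^sub>r / r\<close> over all odd integers \<open>r\<close>, with \<open>r\<close> and \<open>-r\<close> grouped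
  together.
\<close>

definition odd_part_term :: "(int \<Rightarrow> 'a::chilbert_space) \<Rightarrow> nat \<Rightarrow> 'a" where
  "odd_part_term x k =
     complex_of_real (1 / (2 * real k + 1)) *\<^sub>C (x (2 * int k + 1) - x (- (2 * int k + 1)))"

definition odd_part :: "(int \<Rightarrow> 'a::chilbert_space) \<Rightarrow> 'a" where
  "odd_part x = (\<Sum>k. odd_part_term x k)"

lemma cinner_suminf_right:
  "summable f \<Longrightarrow> (\<lambda>k. cinner x (f k)) sums cinner x (\<Sum>k. f k)"
  by (rule bounded_linear.sums[OF bounded_linear_cinner_right summable_sums])

lemma cinner_odd_part_right:
  assumes gram: "\<And>i j. cinner (x i) (y j) = (if i + d = j then \<kappa> else 0)"
    and sy: "summable (odd_part_term y)"
  shows "cinner (x i) (odd_part y) = \<kappa> * of_real (odd_recip (i + d))"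
proof -
  have summand: "cinner (x i) (odd_part_term y k) = of_real (1 / (2 * real k + 1)) *
      ((if i + d = 2 * int k + 1 then \<kappa> else 0) - (if i + d = - (2 * int k + 1) then \<kappa> else 0))" for k
    by (simp add: odd_part_term_def cinner_scaleC_right cinner_diff_right gram)
  have "(\<lambda>k. cinner (x i) (odd_part_term y k)) sums (\<kappa> * of_real (odd_recip (i + d)))"
  proof (cases "odd (i + d)")
    case False
    then have "i + d \<noteq> 2 * int k + 1" "i + d \<noteq> - (2 * int k + 1)" for k
      by (presburger, presburger)
    then have "cinner (x i) (odd_part_term y k) = 0" for k unfolding summand by simp
    then show ?thesis using False by (simp add: odd_recip_def)
  next
    case odd: True
    define k0 where "k0 = nat (\<bar>i + d\<bar> div 2)"
    have k0: "\<bar>i + d\<bar> = 2 * int k0 + 1" using odd by (simp add: k0_def odd_two_times_div_two_succ)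
    have "cinner (x i) (odd_part_term y k) = (if k = k0 then \<kappa> * of_real (odd_recip (i + d)) else 0)"
      for k
    proof (cases "i + d > 0")
      case True
      then have "i + d = 2 * int k0 + 1" using k0 by simp
      then show ?thesis unfolding summand by (auto simp: odd_recip_def)
    next
      case False
      then have eq: "i + d = - (2 * int k0 + 1)" using k0 by simp
      have "odd_recip (i + d) = - (1 / (2 * real k0 + 1))"
        unfolding eq odd_recip_minus by (simp add: odd_recip_def)
      then show ?thesis unfolding summand using eq by auto
    qed
    then show ?thesis using sums_single[of k0 "\<lambda>_. \<kappa> * of_real (odd_recip (i + d))"] by simp
  qed
  then show ?thesis
    using cinner_suminf_right[OF sy, of "x i"] sums_unique2 unfolding odd_part_def by blast
qed

text \<open>
  Think of a unitary \<open>T\<close> with \<open>T x\<^sub>j = x\<^sub>j\<^sub>+\<^sub>1\<close> and \<open>T y\<^sub>j = y\<^sub>j\<^sub>+\<^sub>1\<close>.  The vectors are \<open>(a + \<i> h(T)) x\<^sub>0\<close>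
  and \<open>(a - \<i> h(T)) y\<^sub>0\<close>, where \<open>h(T) = \<Sum> T\<^sup>r / r\<close> over odd \<open>r\<close>.  The function
  \<open>\<i> h\<close> on the unit circle is a square wave with values \<open>\<plusminus>a\<close>, so the two functions of \<open>T\<close> have
  disjoint supports.
\<close>

lemma square_wave_orthogonal:
  assumes gram: "\<And>i j. cinner (x i) (y j) = (if i + d = j then \<kappa> else 0)"
    and sx: "summable (odd_part_term x)" and sy: "summable (odd_part_term y)"
    and a: "a * a = odd_square_sum"
  shows "cinner (of_real a *\<^sub>C x 0 + \<i> *\<^sub>C odd_part x) (of_real a *\<^sub>C y 0 - \<i> *\<^sub>C odd_part y) = 0"
proof -
  note right = cinner_odd_part_right[OF gram sy]
  have "cinner (y j) (x i) = (if j + - d = i then cnj \<kappa> else 0)" for i j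
    by (subst cinner_commute) (auto simp: gram)
  from cinner_odd_part_right[OF this sx]
  have left: "cinner (odd_part x) (y j) = \<kappa> * of_real (odd_recip (j - d))" for j
    by (subst cinner_commute) simp
  have "(\<lambda>k. cnj (cinner (odd_part y) (odd_part_term x k))) sums cnj (cinner (odd_part y) (odd_part x))"
    unfolding odd_part_def[of x] sums_cnj by (rule cinner_suminf_right[OF sx])
  then have "(\<lambda>k. cinner (odd_part_term x k) (odd_part y)) sums cinner (odd_part x) (odd_part y)"
    by (simp only: cinner_commute[symmetric])
  moreover have "cinner (odd_part_term x k) (odd_part y) = \<kappa> * of_real ((1 / (2 * real k + 1)) *
      (odd_recip (2 * int k + 1 + d) - odd_recip (- (2 * int k + 1) + d)))" for k
    unfolding odd_part_term_def cinner_scaleC_left cinner_diff_left right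
    by (simp add: algebra_simps)
  moreover have "(\<lambda>k. \<kappa> * of_real ((1 / (2 * real k + 1)) *
      (odd_recip (2 * int k + 1 + d) - odd_recip (- (2 * int k + 1) + d))))
      sums (\<kappa> * of_real (if d = 0 then odd_square_sum else 0))"
    by (intro sums_mult sums_of_real odd_recip_convolution)
  ultimately have both: "cinner (odd_part x) (odd_part y) =
      \<kappa> * of_real (if d = 0 then odd_square_sum else 0)"
    by (simp only: sums_unique2)
  have "cinner (x 0) (y 0) = (if d = 0 then \<kappa> else 0)" by (simp add: gram)
  then show ?thesis
    using right[of 0] left[of 0] both odd_recip_minus[of d]
    by (simp add: cinner_add_left cinner_diff_right cinner_scaleC_left cinner_scaleC_right
        a[symmetric] algebra_simps odd_recip_def)
qed

section \<open>Infinite chains\<close>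

lemma summable_int_shift:
  fixes f :: "int \<Rightarrow> real"
  assumes "summable (\<lambda>t. f (c + int t))"
  shows "summable (\<lambda>t. f (d + int t))"
proof (cases "c \<le> d")
  case True
  have "(\<lambda>t. f (d + int t)) = (\<lambda>t. f (c + int (t + nat (d - c))))"
    using True by (simp add: add.commute)
  then show ?thesis using assms summable_iff_shift[of "\<lambda>t. f (c + int t)" "nat (d - c)"] by simp
next
  case False
  have "(\<lambda>t. f (c + int t)) = (\<lambda>t. f (d + int (t + nat (c - d))))"
    using False by (simp add: add.commute)
  then show ?thesis using assms summable_iff_shift[of "\<lambda>t. f (d + int t)" "nat (c - d)"] by simp
qed

context cuntz_representation
begin

subsection \<open>Chains for asymptotic parameters\<close>

fun iterate_along :: "(int \<Rightarrow> complex ^ 'n) \<Rightarrow> nat \<Rightarrow> int \<Rightarrow> 'h \<Rightarrow> 'h" where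
  "iterate_along z 0 n x = x"
| "iterate_along z (Suc T) n x = S (z n) (iterate_along z T (n + 1) x)"

lemma iterate_along_add:
  "iterate_along z (T + R) n x = iterate_along z T n (iterate_along z R (n + int T) x)"
  by (induction T arbitrary: n) (simp_all add: ac_simps)

lemma norm_iterate_along_diff:
  assumes "\<And>n. norm (z n) = 1"
  shows "norm (iterate_along z T n x - iterate_along z T n y) = norm (x - y)"
  by (induction T arbitrary: n) (simp_all add: norm_S assms flip: rep_diff_right)

lemma norm_iterate_along:
  assumes "\<And>n. norm (z n) = 1"
  shows "norm (iterate_along z T n x) = norm x"
  by (induction T arbitrary: n) (simp_all add: norm_S assms)

lemma cinner_iterate_along:
  assumes "chain z' X"
  shows "cinner (iterate_along z T n x) (X n) =
    (\<Prod>t<T. vec_cinner (z (n + int t)) (z' (n + int t))) * cinner x (X (n + int T))"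
proof (induction T arbitrary: n)
  case (Suc T)
  have "cinner (iterate_along z (Suc T) n x) (X n) =
      vec_cinner (z n) (z' n) * cinner (iterate_along z T (n + 1) x) (X (n + 1))"
    using assms cinner_S unfolding chain_def by (metis iterate_along.simps(2))
  then show ?case unfolding Suc prod.lessThan_Suc_shift by (simp add: ac_simps)
qed simp

text \<open>
  If \<open>\<Sum>\<^sub>n \<bar>1 - \<langle>z\<^sub>n|z'\<^sub>n\<rangle>\<bar>\<close> converges, the vectors \<open>s(z\<^sub>n) \<dots> s(z\<^sub>n\<^sub>+\<^sub>T\<^sub>-\<^sub>1) X\<^sub>n\<^sub>+\<^sub>T\<close> converge as
  \<open>T \<rightarrow> \<infinity>\<close>, because two of them have an inner product equal to a block of the convergent
  product \<open>\<Prod> \<langle>z\<^sub>n|z'\<^sub>n\<rangle>\<close>.  The limits form a chain for \<open>z\<close> that is asymptotic to the given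
  chain for \<open>z'\<close>.
\<close>

lemma asymptotic_chain_exists:
  assumes X: "chain z' X" and unit: "\<And>n. norm (z n) = 1" "\<And>n. norm (z' n) = 1"
    and sm: "summable (\<lambda>t. cmod (1 - vec_cinner (z (int t)) (z' (int t))))"
  shows "\<exists>Y. chain z Y \<and> (\<forall>n. (\<lambda>T. Y (n + int T) - X (n + int T)) \<longlonglongrightarrow> 0)"
proof -
  define b where "b n = cmod (1 - vec_cinner (z n) (z' n))" for n
  define c where "c = (norm (X 0))\<^sup>2"
  have dist: "(norm (iterate_along z R m (X (m + int R)) - X m))\<^sup>2 \<le> 2 * c * (\<Sum>t<R. b (m + int t))"
    for m R
  proof -
    define Q where "Q = (\<Prod>t<R. vec_cinner (z (m + int t)) (z' (m + int t)))"
    have nX: "(norm (X i))\<^sup>2 = c" for i using chain_norm[OF X unit(2), of i 0] by (simp add: c_def)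
    have "cinner (iterate_along z R m (X (m + int R))) (X m) = Q * of_real c"
      unfolding cinner_iterate_along[OF X] Q_def cinner_self nX ..
    then have "(norm (iterate_along z R m (X (m + int R)) - X m))\<^sup>2 = 2 * c * Re (1 - Q)"
      by (simp add: norm_diff_square norm_iterate_along[OF unit(1)] nX algebra_simps)
    also have "\<dots> \<le> 2 * c * cmod (1 - Q)"
      by (intro mult_left_mono complex_Re_le_cmod) (simp add: c_def)
    also have "cmod (1 - Q) \<le> (\<Sum>t<R. b (m + int t))"
      using norm_prod_diff[of "{..<R}" "\<lambda>_. 1" "\<lambda>t. vec_cinner (z (m + int t)) (z' (m + int t))"]
        cmod_vec_cinner_le_one[OF unit]
      by (simp add: Q_def b_def)
    finally show ?thesis by (simp add: c_def mult_left_mono)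
  qed
  have small: "\<exists>M. \<forall>T\<ge>M. \<forall>R. norm (iterate_along z R (n + int T) (X (n + int T + int R))
      - X (n + int T)) < e" if e: "e > 0" for n e
  proof -
    have "summable (\<lambda>t. b (0 + int t))" using sm by (simp add: b_def)
    then have "summable (\<lambda>t. b (n + int t))" by (rule summable_int_shift)
    then have "summable (\<lambda>t. 2 * c * b (n + int t))" by (rule summable_mult)
    then obtain M where M: "\<And>m k. m \<ge> M \<Longrightarrow> norm (\<Sum>t=m..<k. 2 * c * b (n + int t)) < e\<^sup>2"
      using e unfolding summable_Cauchy by (metis zero_less_power)
    have "norm (iterate_along z R (n + int T) (X (n + int T + int R)) - X (n + int T)) < e"
      if "T \<ge> M" for T R
    proof -
      have "(\<Sum>t<R. b (n + int T + int t)) = (\<Sum>t=T..<T + R. b (n + int t))"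
        using sum.shift_bounds_nat_ivl[of "\<lambda>t. b (n + int t)" 0 T R]
        by (simp add: lessThan_atLeast0 ac_simps)
      then have "2 * c * (\<Sum>t<R. b (n + int T + int t)) = (\<Sum>t=T..<T + R. 2 * c * b (n + int t))"
        by (simp add: sum_distrib_left)
      also have "\<dots> < e\<^sup>2" using M[OF that, of "T + R"] by (simp add: abs_less_iff)
      finally have "(norm (iterate_along z R (n + int T) (X (n + int T + int R)) - X (n + int T)))\<^sup>2 < e\<^sup>2"
        using dist[where m = "n + int T" and R = R] by linarith
      then show ?thesis using e by (simp add: power2_less_imp_less)
    qed
    then show ?thesis by blast
  qed
  define U where "U n T = iterate_along z T n (X (n + int T))" for n T
  have U_diff: "norm (U n (T + R) - U n T)
      = norm (iterate_along z R (n + int T) (X (n + int T + int R)) - X (n + int T))" for n T R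
    by (simp only: U_def iterate_along_add norm_iterate_along_diff[OF unit(1)] of_nat_add add.assoc)
  have "\<exists>y. U n \<longlonglongrightarrow> y" for n
  proof -
    have "Cauchy (U n)"
    proof (rule CauchyI')
      fix e :: real assume "e > 0"
      then obtain M where M: "\<And>T R. T \<ge> M \<Longrightarrow> norm (U n (T + R) - U n T) < e"
        using small[of e n] unfolding U_diff by blast
      have "dist (U n m) (U n k) < e" if "m \<ge> M" "k > m" for m k
        using M[OF that(1), of "k - m"] that(2) by (simp add: dist_norm norm_minus_commute)
      then show "\<exists>M. \<forall>m\<ge>M. \<forall>k>m. dist (U n m) (U n k) < e" by blast
    qed
    then show ?thesis using Cauchy_convergent_iff convergent_def by blast
  qed
  then obtain Y where Y: "\<And>n. U n \<longlonglongrightarrow> Y n" by metis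
  have "chain z Y"
    unfolding chain_def
  proof
    fix n
    have "U n (Suc T) = S (z n) (U (n + 1) T)" for T by (simp add: U_def ac_simps)
    then have "(\<lambda>T. U n (Suc T)) \<longlonglongrightarrow> S (z n) (Y (n + 1))"
      using bounded_linear.tendsto[OF rep_bounded_linear Y] by simp
    moreover have "(\<lambda>T. U n (Suc T)) \<longlonglongrightarrow> Y n" using Y by (rule LIMSEQ_Suc)
    ultimately show "Y n = S (z n) (Y (n + 1))" using LIMSEQ_unique by blast
  qed
  moreover have "(\<lambda>T. Y (n + int T) - X (n + int T)) \<longlonglongrightarrow> 0" for n
  proof (rule LIMSEQ_I)
    fix e :: real assume e: "e > 0"
    then obtain M where M: "\<And>T R. T \<ge> M \<Longrightarrow>
        norm (iterate_along z R (n + int T) (X (n + int T + int R)) - X (n + int T)) < e / 2"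
      using small[of "e / 2" n] by auto
    have close: "norm (Y (n + int T) - X (n + int T)) \<le> e / 2" if "T \<ge> M" for T
    proof (rule LIMSEQ_le_const2)
      show "(\<lambda>R. norm (U (n + int T) R - X (n + int T))) \<longlonglongrightarrow> norm (Y (n + int T) - X (n + int T))"
        by (intro tendsto_intros Y)
      show "\<exists>N. \<forall>R\<ge>N. norm (U (n + int T) R - X (n + int T)) \<le> e / 2"
        using M[OF that] by (intro exI[of _ 0]) (auto simp: U_def intro: less_imp_le)
    qed
    have "norm (Y (n + int T) - X (n + int T) - 0) < e" if "T \<ge> M" for T
      using close[OF that] e by simp
    then show "\<exists>M. \<forall>T\<ge>M. norm (Y (n + int T) - X (n + int T) - 0) < e" by blast
  qed
  ultimately show ?thesis by blast
qed

text \<open>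
  Inner products of chains are determined by their asymptotic behaviour: in \<open>chain_cinner\<close> the
  far members \<open>X\<^sub>n\<^sub>+\<^sub>T\<close> and \<open>Y\<^sub>m\<^sub>+\<^sub>T\<close> may be replaced by \<open>X'\<^sub>n\<^sub>+\<^sub>T\<close> and \<open>Y'\<^sub>m\<^sub>+\<^sub>T\<close> with an error that
  tends to 0.
\<close>

lemma asymptotic_chains_cinner:
  assumes z: "\<And>n. norm (z n) = 1"
    and X: "chain z X" and Y: "chain z Y" and norm_X': "\<And>n. norm (X' n) = 1"
    and XX': "\<And>n. (\<lambda>T. X (n + int T) - X' (n + int T)) \<longlonglongrightarrow> 0"
    and YY': "\<And>n. (\<lambda>T. Y (n + int T) - Y' (n + int T)) \<longlonglongrightarrow> 0"
    and gram: "\<And>T. cinner (X' (n + int T)) (Y' (m + int T)) = g"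
  shows "(\<lambda>T. (\<Prod>t<T. vec_cinner (z (n + int t)) (z (m + int t))) * g) \<longlonglongrightarrow> cinner (X n) (Y m)"
proof -
  define Q where "Q T = (\<Prod>t<T. vec_cinner (z (n + int t)) (z (m + int t)))" for T
  have Q_le: "cmod (Q T) \<le> 1" for T
    using cmod_vec_cinner_le_one[OF z z] unfolding Q_def by (simp add: prod_norm[symmetric] prod_le_1)
  define \<epsilon> where "\<epsilon> T = norm (X (n + int T) - X' (n + int T)) * norm (Y 0)
      + norm (Y (m + int T) - Y' (m + int T))" for T
  have "(\<lambda>T. \<epsilon> T) \<longlonglongrightarrow> 0 * norm (Y 0) + 0"
    unfolding \<epsilon>_def by (intro tendsto_intros tendsto_norm_zero XX' YY')
  then have \<epsilon>: "\<epsilon> \<longlonglongrightarrow> 0" by simp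
  have bound: "cmod (Q T * g - cinner (X n) (Y m)) \<le> \<epsilon> T" for T
  proof -
    let ?x = "X (n + int T)" and ?x' = "X' (n + int T)" and ?y = "Y (m + int T)" and ?y' = "Y' (m + int T)"
    have "Q T * g - cinner (X n) (Y m) = - (Q T * (cinner (?x - ?x') ?y + cinner ?x' (?y - ?y')))"
      by (subst chain_cinner[OF X Y, of n m T])
         (simp add: Q_def gram[of T, symmetric] cinner_diff_left cinner_diff_right algebra_simps)
    then have "cmod (Q T * g - cinner (X n) (Y m))
        = cmod (Q T) * cmod (cinner (?x - ?x') ?y + cinner ?x' (?y - ?y'))"
      by (simp add: norm_mult)
    also have "\<dots> \<le> 1 * cmod (cinner (?x - ?x') ?y + cinner ?x' (?y - ?y'))"
      by (intro mult_right_mono Q_le) simp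
    also have "\<dots> \<le> norm (?x - ?x') * norm ?y + norm ?x' * norm (?y - ?y')"
      using norm_triangle_mono[OF Cauchy_Schwarz_cinner Cauchy_Schwarz_cinner] by simp
    finally show ?thesis
      using chain_norm[OF Y z, of "m + int T" 0] by (simp add: \<epsilon>_def norm_X')
  qed
  have "(\<lambda>T. Q T * g - cinner (X n) (Y m)) \<longlonglongrightarrow> 0"
    by (rule tendsto_norm_zero_cancel, rule tendsto_sandwich[OF _ _ tendsto_const \<epsilon>]) (use bound in auto)
  then show ?thesis unfolding Q_def[symmetric] by (rule LIM_zero_cancel)
qed

text \<open>
  The chains \<open>\<xi>\<^sub>j\<close> for \<open>z\<close> that are asymptotic to \<open>X\<close> shifted by \<open>pj\<close> form an orthonormal family.
  The inner product of a member of \<open>\<xi>\<^sub>i\<close> with a member of \<open>\<xi>\<^sub>j\<close> depends on \<open>i\<close> and \<open>j\<close> only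
  through \<open>j - i\<close>, as if a bilateral shift \<open>\<xi>\<^sub>j \<mapsto> \<xi>\<^sub>j\<^sub>+\<^sub>1\<close> commuted with the representation.  Square waves
  in this shift give the two orthogonal chains.
\<close>

theorem reducible_if_asymptotic_to_shift:
  assumes unit: "\<And>n. norm (z n) = 1" and X: "chain z X"
    and orth: "\<And>n m. cinner (X n) (X m) = (if n = m then 1 else 0)"
    and p: "p > 0" and sm: "summable (\<lambda>t. cmod (1 - vec_cinner (z (int t)) (z (int t + p))))"
  shows "\<not> irreducible_rep \<pi>"
proof -
  \<comment> \<open>The start index 0 is written out in the form in which \<open>summable_int_shift\<close> applies.\<close>
  define near where "near q \<longleftrightarrow> summable (\<lambda>t. cmod (1 - vec_cinner (z (0 + int t)) (z (0 + int t + q))))" for q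
  have near_add: "near (q + r)" if "near q" "near r" for q r
  proof -
    have "summable (\<lambda>t. cmod (1 - vec_cinner (z (q + int t)) (z (q + int t + r))))"
      using that(2) unfolding near_def by (rule summable_int_shift)
    then have "summable (\<lambda>t. 2 * (cmod (1 - vec_cinner (z (0 + int t)) (z (0 + int t + q)))
        + cmod (1 - vec_cinner (z (q + int t)) (z (q + int t + r)))))"
      using that(1) unfolding near_def by (intro summable_mult summable_add)
    then show ?thesis
      unfolding near_def
    proof (rule summable_comparison_test'[where N = 0])
      fix t :: nat
      show "norm (cmod (1 - vec_cinner (z (0 + int t)) (z (0 + int t + (q + r)))))
          \<le> 2 * (cmod (1 - vec_cinner (z (0 + int t)) (z (0 + int t + q)))
            + cmod (1 - vec_cinner (z (q + int t)) (z (q + int t + r))))"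
        using one_minus_cinner_quasi_triangle[of "z (int t)" "z (q + int t)" "z (q + int t + r)",
            OF unit unit unit]
        by (simp add: vec_cinner_eq_cinner ac_simps)
    qed
  qed
  have near_minus: "near (- q)" if "near q" for q
  proof -
    have "cmod (1 - vec_cinner (z (- q + int t)) (z (- q + int t + q)))
        = cmod (1 - vec_cinner (z (0 + int t)) (z (0 + int t + - q)))" for t
    proof -
      have "1 - cinner (z (int t)) (z (int t - q)) = cnj (1 - cinner (z (int t - q)) (z (int t)))"
        by (subst cinner_commute) simp
      then show ?thesis by (simp add: vec_cinner_eq_cinner ac_simps del: complex_cnj_diff)
    qed
    moreover have "summable (\<lambda>t. cmod (1 - vec_cinner (z (- q + int t)) (z (- q + int t + q))))"
      using that unfolding near_def by (rule summable_int_shift)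
    ultimately show ?thesis unfolding near_def by simp
  qed
  have near_p: "near p" using sm by (simp add: near_def)
  have near: "near (p * j)" for j
  proof (induction j rule: int_induct[of _ 0])
    case base
    show ?case by (simp add: near_def vec_cinner_self unit)
  next
    case (step1 i)
    then show ?case using near_add[OF _ near_p, of "p * i"] by (simp add: algebra_simps)
  next
    case (step2 i)
    then show ?case using near_add[OF _ near_minus[OF near_p], of "p * i"] by (simp add: algebra_simps)
  qed
  have "\<exists>Y. chain z Y \<and> (\<forall>n. (\<lambda>T. Y (n + int T) - X (n + int T + p * j)) \<longlonglongrightarrow> 0)" for j
  proof (rule asymptotic_chain_exists[where z' = "\<lambda>n. z (n + p * j)"])
    show "chain (\<lambda>n. z (n + p * j)) (\<lambda>n. X (n + p * j))"
      using X unfolding chain_def by (metis add.commute add.left_commute)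
    show "summable (\<lambda>t. cmod (1 - vec_cinner (z (int t)) (z (int t + p * j))))"
      using near[of j] by (simp add: near_def)
  qed (rule unit)+
  then obtain \<xi> where \<xi>_asym: "\<And>j. chain z (\<xi> j) \<and>
      (\<forall>n. (\<lambda>T. \<xi> j (n + int T) - X (n + int T + p * j)) \<longlonglongrightarrow> 0)" by metis
  then have \<xi>: "\<And>j. chain z (\<xi> j)"
    and asym: "\<And>j n. (\<lambda>T. \<xi> j (n + int T) - X (n + int T + p * j)) \<longlonglongrightarrow> 0" by (blast, blast)
  have normX: "norm (X n) = 1" for n using orth[of n n] by (simp add: norm_eq_one_iff)
  define \<kappa> where "\<kappa> n m = lim (\<lambda>T. \<Prod>t<T. vec_cinner (z (n + int t)) (z (m + int t)))" for n m
  have gram: "cinner (\<xi> i n) (\<xi> j m) = (if n + p * i = m + p * j then \<kappa> n m else 0)" for i j n m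
  proof -
    have "(\<lambda>T. (\<Prod>t<T. vec_cinner (z (n + int t)) (z (m + int t)))
        * (if n + p * i = m + p * j then 1 else 0)) \<longlonglongrightarrow> cinner (\<xi> i n) (\<xi> j m)"
      by (rule asymptotic_chains_cinner[OF unit \<xi> \<xi> _ asym asym]) (auto simp: normX orth)
    then show ?thesis
      by (cases "n + p * i = m + p * j") (simp_all add: \<kappa>_def limI LIMSEQ_const_iff)
  qed
  have \<kappa>_diag: "\<kappa> n n = 1" for n by (simp add: \<kappa>_def vec_cinner_self unit)
  have sm_odd: "summable (odd_part_term (\<lambda>j. \<xi> j n))" for n
  proof (rule summable_orthogonal_series)
    have same: "cinner (\<xi> i n) (\<xi> j n) = (if i = j then 1 else 0)" for i j
      using p by (simp add: gram \<kappa>_diag)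
    show "cinner (odd_part_term (\<lambda>j. \<xi> j n) k) (odd_part_term (\<lambda>j. \<xi> j n) l) = 0" if "k \<noteq> l" for k l
      using that by (simp add: odd_part_term_def cinner_scaleC_left cinner_scaleC_right
          cinner_diff_left cinner_diff_right same)
    have "(norm (odd_part_term (\<lambda>j. \<xi> j n) k))\<^sup>2 = 2 / (2 * real k + 1)\<^sup>2" for k
    proof -
      have "(norm (\<xi> (2 * int k + 1) n - \<xi> (- (2 * int k + 1)) n))\<^sup>2 = 2"
        using same[of i i for i] by (simp add: norm_diff_square same norm_eq_one_iff[THEN iffD2])
      then show ?thesis
        unfolding odd_part_term_def norm_scaleC_chilbert power_mult_distrib norm_of_real
        by (simp add: power_divide)
    qed
    then show "summable (\<lambda>k. (norm (odd_part_term (\<lambda>j. \<xi> j n) k))\<^sup>2)"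
      using summable_odd_squares by simp
  qed
  define h where "h n = odd_part (\<lambda>j. \<xi> j n)" for n
  have h: "chain z h"
    unfolding chain_def
  proof
    fix n
    have step: "\<xi> j n = S (z n) (\<xi> j (n + 1))" for j using \<xi> unfolding chain_def by blast
    have "odd_part_term (\<lambda>j. \<xi> j n) = (\<lambda>k. S (z n) (odd_part_term (\<lambda>j. \<xi> j (n + 1)) k))"
      unfolding odd_part_term_def rep_scaleC_right rep_diff_right step[symmetric] ..
    then show "h n = S (z n) (h (n + 1))"
      unfolding h_def odd_part_def
      by (simp only: bounded_linear.suminf[OF rep_bounded_linear sm_odd[of "n + 1"]])
  qed
  define a where "a = sqrt odd_square_sum"
  have a: "a * a = odd_square_sum" "a \<noteq> 0" using odd_square_sum_pos by (simp_all add: a_def)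
  have nonzero: "of_real a *\<^sub>C \<xi> 0 0 + c *\<^sub>C h 0 \<noteq> 0" for c
  proof
    assume *: "of_real a *\<^sub>C \<xi> 0 0 + c *\<^sub>C h 0 = 0"
    have "cinner (\<xi> i 0) (\<xi> j 0) = (if i + 0 = j then 1 else 0)" for i j
      using p by (simp add: gram \<kappa>_diag)
    from cinner_odd_part_right[OF this sm_odd[of 0], of 0] this[of 0 0]
    have "cinner (\<xi> 0 0) (of_real a *\<^sub>C \<xi> 0 0 + c *\<^sub>C h 0) = of_real a"
      by (simp add: h_def cinner_add_right cinner_scaleC_right odd_recip_def)
    then show False using * a(2) by simp
  qed
  show ?thesis
  proof (rule reducible_if_orthogonal_chains)
    show "chain z (\<lambda>n. of_real a *\<^sub>C \<xi> 0 n + \<i> *\<^sub>C h n)"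
      by (intro chain_add chain_scaleC \<xi> h)
    show "chain z (\<lambda>n. of_real a *\<^sub>C \<xi> 0 n - \<i> *\<^sub>C h n)"
      by (intro chain_diff chain_scaleC \<xi> h)
    show "of_real a *\<^sub>C \<xi> 0 0 + \<i> *\<^sub>C h 0 \<noteq> 0" by (rule nonzero)
    show "of_real a *\<^sub>C \<xi> 0 0 - \<i> *\<^sub>C h 0 \<noteq> 0" using nonzero[of "- \<i>"] by (simp add: scaleC_minus_left)
    fix n m
    have "\<exists>d \<kappa>'. \<forall>i j. cinner (\<xi> i n) (\<xi> j m) = (if i + d = j then \<kappa>' else 0)"
    proof (cases "p dvd n - m")
      case True
      then obtain d where "n - m = p * d" by (elim dvdE)
      then have shifted: "n + p * i = m + p * (i + d)" for i by (simp add: algebra_simps)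
      have "(n + p * i = m + p * j) = (i + d = j)" for i j
        unfolding shifted using p by simp
      then show ?thesis unfolding gram by (intro exI[of _ d] exI[of _ "\<kappa> n m"]) simp
    next
      case False
      have "n + p * i \<noteq> m + p * j" for i j
      proof
        assume "n + p * i = m + p * j"
        then have "n - m = p * (j - i)" by (simp add: algebra_simps)
        then show False using False by simp
      qed
      then show ?thesis unfolding gram by (intro exI[of _ 0]) auto
    qed
    then obtain d \<kappa>' where "\<And>i j. cinner (\<xi> i n) (\<xi> j m) = (if i + d = j then \<kappa>' else 0)" by blast
    from square_wave_orthogonal[OF this sm_odd sm_odd a(1)]
    show "cinner (of_real a *\<^sub>C \<xi> 0 n + \<i> *\<^sub>C h n) (of_real a *\<^sub>C \<xi> 0 m - \<i> *\<^sub>C h m) = 0"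
      unfolding h_def .
  qed
qed

subsection \<open>From the defining family of an infinite chain to chains over the integers\<close>

lemma S_adjoint_isometric_imp:
  assumes v: "norm v = 1" and eq: "norm (\<pi> (star (s_vec s v)) x) = norm x"
  shows "S v (\<pi> (star (s_vec s v)) x) = x"
proof -
  have "cinner x (S v (\<pi> (star (s_vec s v)) x)) = of_real ((norm x)\<^sup>2)"
    by (simp add: rep_adjoint_right cinner_self eq del: of_real_power)
  then have "(norm (x - S v (\<pi> (star (s_vec s v)) x)))\<^sup>2 = 0"
    by (simp add: norm_diff_square norm_S[OF v] eq del: of_real_power)
  then show ?thesis by simp
qed

text \<open>
  All vectors \<open>s(z\<^sub>n\<^sub>-\<^sub>1)\<^sup>* \<dots> s(z\<^sub>0)\<^sup>* \<Omega>\<close> have norm 1, so no adjoint shortens its argument, and the adjoints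
  can be undone.  At negative indices the chain is continued by applying \<open>s(z\<^sub>0)\<close>.  The
  orthogonality of members that do not belong to the given family, such as \<open>\<Omega>\<close>, follows by moving
  both indices far to the right.
\<close>

lemma GP_chain_imp_chain:
  assumes GP: "GP_chain s \<pi> z" and unit: "\<And>n. norm (z n) = 1"
  obtains X where "chain (\<lambda>n. z (nat n)) X" "unit_cyclic_vector \<pi> (X 0)"
    "\<And>n m. cinner (X n) (X m) = (if n = m then 1 else 0)"
proof -
  obtain \<Omega> where cyc: "unit_cyclic_vector \<pi> \<Omega>"
    and fam: "orthonormal_family UNIV
          (\<lambda>n. \<pi> (prod_list (map (\<lambda>i. star (s_vec s (z i))) (rev [0..<Suc n]))) \<Omega>)"
    using GP unfolding GP_chain_def by blast
  define Y where "Y n = \<pi> (prod_list (map (\<lambda>i. star (s_vec s (z i))) (rev [0..<n]))) \<Omega>" for n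
  have Y0: "Y 0 = \<Omega>" by (simp add: Y_def rep_one)
  have Y_Suc: "Y (Suc n) = \<pi> (star (s_vec s (z n))) (Y n)" for n
    by (simp add: Y_def rep_mult)
  have Y_orth: "cinner (Y (Suc n)) (Y (Suc m)) = (if n = m then 1 else 0)" for n m
    using fam unfolding orthonormal_family_def Y_def by simp
  have Y_norm: "norm (Y n) = 1" for n
    using cyc Y_orth by (cases n) (simp_all add: Y0 unit_cyclic_vector_def norm_eq_one_iff)
  have Y_step: "Y n = S (z n) (Y (Suc n))" for n
    unfolding Y_Suc using S_adjoint_isometric_imp[OF unit, of n "Y n"]
    by (simp add: Y_norm flip: Y_Suc)
  define X where "X n = (if n \<ge> 0 then Y (nat n) else (S (z 0) ^^ nat (- n)) \<Omega>)" for n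
  have X: "chain (\<lambda>n. z (nat n)) X"
    unfolding chain_def
  proof
    fix n :: int
    show "X n = S (z (nat n)) (X (n + 1))"
    proof (cases "n \<ge> 0")
      case True
      then show ?thesis using Y_step[of "nat n"] by (simp add: X_def nat_add_distrib)
    next
      case False
      have "X (n + 1) = (S (z 0) ^^ nat (- (n + 1))) \<Omega>"
        using False Y0 by (cases "n = - 1") (simp_all add: X_def)
      moreover have "nat (- n) = Suc (nat (- (n + 1)))" using False by simp
      ultimately show ?thesis using False by (simp add: X_def)
    qed
  qed
  have "cinner (X n) (X m) = (if n = m then 1 else 0)" for n m
  proof (cases "n = m")
    case True
    then show ?thesis
      using chain_norm[OF X, of m 0] unit cyc norm_eq_one_iff[of "X m"]
      by (simp add: X_def Y0 unit_cyclic_vector_def)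
  next
    case False
    define T where "T = Suc (nat \<bar>n\<bar> + nat \<bar>m\<bar>)"
    have "X (n + int T) = Y (Suc (nat (n + int T) - 1))" "X (m + int T) = Y (Suc (nat (m + int T) - 1))"
      by (auto simp: X_def T_def)
    moreover have "nat (n + int T) - 1 \<noteq> nat (m + int T) - 1" using False by (auto simp: T_def)
    ultimately have "cinner (X (n + int T)) (X (m + int T)) = 0" by (simp only: Y_orth if_False)
    then show ?thesis using chain_cinner[OF X X, of n m T] False by simp
  qed
  moreover have "unit_cyclic_vector \<pi> (X 0)" using cyc by (simp add: X_def Y0)
  ultimately show ?thesis using that X by blast
qed

text \<open>
  The phases of the parameters may be changed freely.  A suitable choice makes the inner products
  \<open>\<langle>z\<^sub>n|z\<^sub>n\<^sub>+\<^sub>p\<rangle>\<close> nonnegative, so that asymptotic periodicity controls the numbers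
  \<open>1 - \<langle>z\<^sub>n|z\<^sub>n\<^sub>+\<^sub>p\<rangle>\<close> themselves.
\<close>

lemma GP_chain_phases:
  assumes GP: "GP_chain s \<pi> z" and \<beta>: "\<And>n. cmod (\<beta> n) = 1"
  shows "GP_chain s \<pi> (\<lambda>n. \<beta> n *\<^sub>C z n)"
proof -
  obtain \<Omega> where cyc: "unit_cyclic_vector \<pi> \<Omega>"
    and fam: "orthonormal_family UNIV
          (\<lambda>n. \<pi> (prod_list (map (\<lambda>i. star (s_vec s (z i))) (rev [0..<Suc n]))) \<Omega>)"
    using GP unfolding GP_chain_def by blast
  define c where "c n = (\<Prod>i<n. cnj (\<beta> i))" for n
  have eq: "prod_list (map (\<lambda>i. star (s_vec s (\<beta> i *\<^sub>C z i))) (rev [0..<n]))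
      = c n *\<^sub>C prod_list (map (\<lambda>i. star (s_vec s (z i))) (rev [0..<n]))" for n
  proof (induction n)
    case (Suc n)
    then show ?case
      by (simp add: c_def s_vec_scaleC star_scaleC scaleC_mult_left scaleC_mult_right
          scaleC_scaleC mult.commute)
  qed (simp add: c_def)
  have "cmod (c n) = 1" for n by (simp add: c_def prod_norm[symmetric] \<beta>)
  then have "cnj (c n) * c n = 1" for n by (metis complex_norm_square mult.commute of_real_1 one_power2)
  moreover define Y where "Y n = \<pi> (prod_list (map (\<lambda>i. star (s_vec s (z i))) (rev [0..<Suc n]))) \<Omega>" for n
  ultimately have "orthonormal_family UNIV (\<lambda>n. c (Suc n) *\<^sub>C Y n)"
    using fam unfolding orthonormal_family_def
    by (simp add: cinner_scaleC_left cinner_scaleC_right mult.commute)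
  then have "orthonormal_family UNIV
      (\<lambda>n. \<pi> (prod_list (map (\<lambda>i. star (s_vec s (\<beta> i *\<^sub>C z i))) (rev [0..<Suc n]))) \<Omega>)"
    unfolding eq rep_scaleC_left Y_def .
  then show ?thesis using cyc unfolding GP_chain_def by blast
qed

lemma phases_making_shift_nonnegative:
  fixes z :: "nat \<Rightarrow> complex ^ 'n"
  assumes p: "p > 0"
  obtains \<beta> where "\<And>n. cmod (\<beta> n) = 1"
    "\<And>n. vec_cinner (\<beta> n *\<^sub>C z n) (\<beta> (n + p) *\<^sub>C z (n + p)) = of_real (cmod (vec_cinner (z n) (z (n + p))))"
proof -
  define c where "c n = vec_cinner (z n) (z (n + p))" for n
  define u where "u n = (if c n = 0 then 1 else cnj (sgn (c n)))" for n
  have u: "cmod (u n) = 1" "u n * c n = of_real (cmod (c n))" for n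
  proof -
    show "cmod (u n) = 1" by (simp add: u_def norm_sgn)
    show "u n * c n = of_real (cmod (c n))"
      by (simp add: u_def sgn_eq mult.commute[of "cnj (c n)"] complex_norm_square[symmetric]
          power2_eq_square)
  qed
  \<comment> \<open>Solves \<open>\<beta>(n + p) = \<beta>(n) u(n)\<close> along each residue class modulo \<open>p\<close>, with initial value 1.\<close>
  define \<beta> where "\<beta> n = (\<Prod>j<n div p. u (n mod p + p * j))" for n
  have norm_\<beta>: "cmod (\<beta> n) = 1" for n by (simp add: \<beta>_def prod_norm[symmetric] u)
  have "\<beta> (n + p) = \<beta> n * u n" for n using p by (simp add: \<beta>_def)
  moreover have "cnj (\<beta> n) * \<beta> n = 1" for n
    using norm_\<beta>[of n] by (metis complex_norm_square mult.commute of_real_1 one_power2)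
  moreover have "vec_cinner (\<beta> n *\<^sub>C z n) ((\<beta> n * u n) *\<^sub>C z (n + p)) = (cnj (\<beta> n) * \<beta> n) * (u n * c n)" for n
    by (simp add: vec_cinner_eq_cinner cinner_scaleC_left cinner_scaleC_right c_def mult_ac)
  ultimately have "vec_cinner (\<beta> n *\<^sub>C z n) (\<beta> (n + p) *\<^sub>C z (n + p)) = of_real (cmod (c n))" for n
    by (simp add: u(2))
  then show ?thesis using that norm_\<beta> unfolding c_def by blast
qed

lemma asymptotically_periodic_chain_reducible:
  assumes GP: "GP_chain s \<pi> z" and unit: "\<And>n. norm (z n) = 1" and per: "asymptotically_periodic z"
  shows "\<not> irreducible_rep \<pi>"
proof -
  obtain p where p: "p > 0" and sm: "summable (\<lambda>n. 1 - cmod (vec_cinner (z n) (z (n + p))))"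
    using per unfolding asymptotically_periodic_def by blast
  obtain \<beta> where \<beta>: "\<And>n. cmod (\<beta> n) = 1" "\<And>n. vec_cinner (\<beta> n *\<^sub>C z n) (\<beta> (n + p) *\<^sub>C z (n + p))
      = of_real (cmod (vec_cinner (z n) (z (n + p))))"
    by (rule phases_making_shift_nonnegative[OF p, of z]) blast
  define y where "y n = \<beta> n *\<^sub>C z n" for n
  have y: "norm (y n) = 1" for n by (simp add: y_def norm_scaleC_chilbert \<beta> unit)
  have "GP_chain s \<pi> y" unfolding y_def by (rule GP_chain_phases[OF GP \<beta>(1)])
  then obtain X where X: "chain (\<lambda>n. y (nat n)) X"
    "\<And>n m. cinner (X n) (X m) = (if n = m then 1 else 0)" and "unit_cyclic_vector \<pi> (X 0)"
    by (rule GP_chain_imp_chain[OF _ y]) blast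
  show ?thesis
  proof (rule reducible_if_asymptotic_to_shift[OF y X, of "int p"])
    have "cmod (1 - vec_cinner (y n) (y (n + p))) = 1 - cmod (vec_cinner (z n) (z (n + p)))" for n
    proof -
      have "1 - vec_cinner (y n) (y (n + p)) = of_real (1 - cmod (vec_cinner (z n) (z (n + p))))"
        by (simp add: y_def \<beta>(2))
      then show ?thesis using cmod_vec_cinner_le_one[OF unit unit, of n "n + p"]
        by (simp only: norm_of_real)
    qed
    then show "summable (\<lambda>t. cmod (1 - vec_cinner (y (nat (int t))) (y (nat (int t + int p)))))"
      using sm by (simp flip: of_nat_add)
  qed (use p in simp)
qed

lemma not_asymptotically_periodic_chain_irreducible:
  assumes GP: "GP_chain s \<pi> z" and unit: "\<And>n. norm (z n) = 1" and nonper: "\<not> asymptotically_periodic z"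
  shows "irreducible_rep \<pi>"
proof -
  obtain X where X: "chain (\<lambda>n. z (nat n)) X" "unit_cyclic_vector \<pi> (X 0)"
    and "\<And>n m. cinner (X n) (X m) = (if n = m then 1 else 0)"
    by (rule GP_chain_imp_chain[OF GP unit]) blast
  have diverges: "\<not> summable (\<lambda>t. 1 - cmod (vec_cinner (z (nat (n + int t))) (z (nat (m + int t)))))"
    if "n < m" for n m
  proof
    define f where "f i = 1 - cmod (vec_cinner (z (nat i)) (z (nat (i + (m - n)))))" for i
    assume "summable (\<lambda>t. 1 - cmod (vec_cinner (z (nat (n + int t))) (z (nat (m + int t)))))"
    then have "summable (\<lambda>t. f (n + int t))" by (simp add: f_def algebra_simps)
    then have "summable (\<lambda>t. f (0 + int t))" by (rule summable_int_shift)
    moreover have "f (0 + int t) = 1 - cmod (vec_cinner (z t) (z (t + nat (m - n))))" for t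
      using that by (simp add: f_def nat_add_distrib)
    ultimately show False
      using nonper that unfolding asymptotically_periodic_def
      by (auto dest: spec[of _ "nat (m - n)"])
  qed
  have sym: "cmod (vec_cinner u v) = cmod (vec_cinner v u)" for u v :: "complex ^ 'n"
    unfolding vec_cinner_eq_cinner by (subst cinner_commute) simp
  show ?thesis
  proof (rule irreducible_if_shifts_not_asymptotic[OF _ X])
    fix n m :: int
    consider "n = m" | "n < m" | "m < n" by linarith
    then show "X n = X m \<or>
        \<not> summable (\<lambda>t. 1 - cmod (vec_cinner (z (nat (n + int t))) (z (nat (m + int t)))))"
    proof cases
      case 3
      show ?thesis by (subst sym) (use diverges[OF 3] in blast)
    qed (use diverges in blast)+
  qed (rule unit)
qed

end

theorem theorem1p3:
  fixes s :: "'n::finite \<Rightarrow> 'a::cstar_algebra_1"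
    and \<pi> :: "'a \<Rightarrow> 'h::chilbert_space \<Rightarrow> 'h"
  assumes "CARD('n) \<ge> 2"
    and "cuntz_algebra s"
    and "representation \<pi>"
  shows "(\<forall>z\<in>sphere_tensors. GP_cycle s \<pi> z \<longrightarrow>
            (irreducible_rep \<pi> \<longleftrightarrow> \<not> periodic z)) \<and>
         (\<forall>z. range z \<subseteq> sphere 0 1 \<longrightarrow> GP_chain s \<pi> z \<longrightarrow>
            (irreducible_rep \<pi> \<longleftrightarrow> \<not> asymptotically_periodic z))"
proof -
  interpret cuntz_representation \<pi> s
    using assms(2,3) by unfold_locales (auto simp: cuntz_algebra_def)
  show ?thesis
  proof (intro conjI ballI allI impI)
    fix z :: "'n tensor" assume "GP_cycle s \<pi> z"
    then show "irreducible_rep \<pi> \<longleftrightarrow> \<not> periodic z"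
      using nonperiodic_cycle_irreducible periodic_cycle_reducible by metis
  next
    fix z :: "nat \<Rightarrow> complex ^ 'n"
    assume range: "range z \<subseteq> sphere 0 1" and GP: "GP_chain s \<pi> z"
    have "norm (z n) = 1" for n using range by (simp add: image_subset_iff)
    then show "irreducible_rep \<pi> \<longleftrightarrow> \<not> asymptotically_periodic z"
      using asymptotically_periodic_chain_reducible[OF GP]
        not_asymptotically_periodic_chain_irreducible[OF GP] by metis
  qed
qed

end
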